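(* The class of $(P_7,P_5+K_2)$-free bipartite graphs is factorial.
   Context: Graphs are finite, simple and undirected. A graph is $(H_1,H_2)$-free if it contains no induced subgraph isomorphic to $H_1$ or $H_2$. $P_m$ is the chordless path with $m$ vertices, and $P_5+K_2$ is the disjoint union of $P_5$ and $K_2$. A hereditary class (one closed under taking induced subgraphs) is factorial if the number of labelled graphs in it with vertex set $\{1,\ldots,n\}$ is $2^{\Theta(n\log n)}$. *)

theory Defs
  imports Complex_Main "HOL-Library.Landau_Symbols"
begin

type_synonym 'a graph = "'a set \<times> 'a set set"

abbreviation verts :: "'a graph \<Rightarrow> 'a set" where
  "verts G \<equiv> fst G"

abbreviation edges :: "'a graph \<Rightarrow> 'a set set" where
  "edges G \<equiv> snd G"

definition simple_graph :: "'a graph \<Rightarrow> bool" where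
  "simple_graph G \<longleftrightarrow> finite (verts G) \<and> (\<forall>e\<in>edges G. e \<subseteq> verts G \<and> card e = 2)"

definition graph_iso :: "'a graph \<Rightarrow> 'b graph \<Rightarrow> bool" where
  "graph_iso G H \<longleftrightarrow>
     (\<exists>f. bij_betw f (verts G) (verts H) \<and>
        (\<forall>u\<in>verts G. \<forall>v\<in>verts G. {u, v} \<in> edges G \<longleftrightarrow> {f u, f v} \<in> edges H))"

definition induced_subgraph :: "'a graph \<Rightarrow> 'a set \<Rightarrow> 'a graph" where
  "induced_subgraph G U = (U, {e \<in> edges G. e \<subseteq> U})"

definition induced_free :: "'b graph \<Rightarrow> 'a graph \<Rightarrow> bool" where
  "induced_free H G \<longleftrightarrow> \<not> (\<exists>U\<subseteq>verts G. graph_iso (induced_subgraph G U) H)"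

definition bipartite :: "'a graph \<Rightarrow> bool" where
  "bipartite G \<longleftrightarrow>
     (\<exists>A B. A \<union> B = verts G \<and> A \<inter> B = {} \<and>
        (\<forall>e\<in>edges G. \<exists>a\<in>A. \<exists>b\<in>B. e = {a, b}))"

text \<open>The argument of \<open>path_graph\<close> is the number of vertices, not of edges.\<close>

definition path_graph :: "nat \<Rightarrow> nat graph" where
  "path_graph m = ({..<m}, {{i, Suc i} | i. Suc i < m})"

definition complete_graph :: "nat \<Rightarrow> nat graph" where
  "complete_graph m = ({..<m}, {e. e \<subseteq> {..<m} \<and> card e = 2})"

definition disjoint_union :: "'a graph \<Rightarrow> 'b graph \<Rightarrow> ('a + 'b) graph" where
  "disjoint_union G H =
     (verts G <+> verts H, (image Inl ` edges G) \<union> (image Inr ` edges H))"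

text \<open>
  Every finite graph is isomorphic to one whose vertices are natural numbers, so a class of
  graphs is represented by a set of simple graphs with vertices in \<open>nat\<close>. Such a set stands
  for a class of graphs only if it is closed under isomorphism, which is therefore required
  together with closure under induced subgraphs.
\<close>

definition hereditary_class :: "nat graph set \<Rightarrow> bool" where
  "hereditary_class C \<longleftrightarrow>
     (\<forall>G\<in>C. simple_graph G) \<and>
     (\<forall>G\<in>C. \<forall>H. simple_graph H \<and> graph_iso G H \<longrightarrow> H \<in> C) \<and>
     (\<forall>G\<in>C. \<forall>U\<subseteq>verts G. induced_subgraph G U \<in> C)"

definition labelled_count :: "nat graph set \<Rightarrow> nat \<Rightarrow> nat" where
  "labelled_count C n = card {G \<in> C. verts G = {1..n}}"

definition factorial_class :: "nat graph set \<Rightarrow> bool" where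
  "factorial_class C \<longleftrightarrow>
     hereditary_class C \<and>
     (\<exists>g \<in> \<Theta>(\<lambda>n. real n * log 2 (real n)).
        \<forall>\<^sub>F n in sequentially. real (labelled_count C n) = 2 powr g n)"

end

theory Submission
  imports Defs "HOL-Library.FuncSet"
begin

text \<open>
  Fix a bipartition \<open>(A, B)\<close>, which costs a factor \<open>2\<^sup>n\<close>, and regard the graph as a relation
  \<open>E \<subseteq> A \<times> B\<close>. The upper bound then comes from two structural facts.

  If \<open>E\<close> has no induced matching of three edges, look at the sets \<open>M b\<close> of vertices of \<open>A\<close>
  not adjacent to \<open>b\<close>. Forbidding \<open>P\<^sub>7\<close> forces these sets to have chain traces: the sets not
  contained in \<open>M b\<close> cut \<open>M b\<close> in a chain (\<open>complement_chain_relation\<close>). A family with chain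
  traces has a description by \<open>O(n)\<close> numbers up to \<open>n\<close> (\<open>chain_traces_described\<close>). Remove a
  largest set \<open>h\<close>. The sets inside \<open>h\<close> are described recursively on \<open>h\<close>, the others on the
  complement of \<open>h\<close>, and all that remains is how the latter cut \<open>h\<close>. They do so in a chain,
  and the decisive point is that a set whose description refers to another set \<open>g\<close> that is not
  inside \<open>h\<close> meets \<open>h\<close> exactly where \<open>g\<close> does, so that every set needs only one threshold in total.

  If \<open>E\<close> does have an induced matching of three edges, forbidding \<open>P\<^sub>5 + K\<^sub>2\<close> says that a vertex
  adjacent to two of the matching edges is adjacent to all three. Replacing the ends of the
  matching one at a time in all possible ways sweeps out sets \<open>X \<subseteq> A\<close> and \<open>Y \<subseteq> B\<close> such that
  every vertex outside sees \<open>X\<close>, or \<open>Y\<close>, in a homogeneous way, while every vertex inside sees at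
  most one edge of the original matching. Hence every pair in \<open>X \<times> Y\<close> misses one of the three
  matching edges, and the pairs that miss a given edge form a laminar family, which
  has chain traces (\<open>matching3_module\<close>). So \<open>E\<close> is determined by three families with chain traces
  on \<open>X\<close> and \<open>Y\<close> and by the smaller relation in which \<open>X\<close> and \<open>Y\<close> are contracted to one vertex
  each. Counting along this recursion gives \<open>n\<^bsup>O(n)\<^esup>\<close> (\<open>card_free_relations_le\<close>).

  For the lower bound, forests of stars with centres in one half of the vertices contain no
  \<open>P\<^sub>4\<close>, and there is one for each function from the other half to this half.
\<close>

section \<open>Families of sets with chain traces\<close>

definition chain_traces :: "'b set \<Rightarrow> ('b \<Rightarrow> 'a set) \<Rightarrow> bool" where
  "chain_traces B M \<longleftrightarrow>
     (\<forall>b\<in>B. \<forall>c\<in>B. \<forall>d\<in>B. \<not> M c \<subseteq> M b \<longrightarrow> \<not> M d \<subseteq> M b \<longrightarrow>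
        M c \<inter> M b \<subseteq> M d \<or> M d \<inter> M b \<subseteq> M c)"

lemma chain_tracesD:
  assumes "chain_traces B M" "b \<in> B" "c \<in> B" "d \<in> B" "\<not> M c \<subseteq> M b" "\<not> M d \<subseteq> M b"
    "x \<in> M b" "x \<in> M c" "x \<notin> M d" "y \<in> M b" "y \<in> M d"
  shows "y \<in> M c"
  using assms unfolding chain_traces_def by blast

lemma chain_traces_diff:
  assumes "chain_traces B M" "C \<subseteq> B"
  shows "chain_traces C (\<lambda>b. M b - Z)"
  unfolding chain_traces_def
proof (intro ballI impI)
  fix b c d assume "b \<in> C" "c \<in> C" "d \<in> C" "\<not> M c - Z \<subseteq> M b - Z" "\<not> M d - Z \<subseteq> M b - Z"
  moreover from this have "\<not> M c \<subseteq> M b" "\<not> M d \<subseteq> M b" by blast+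
  ultimately have "M c \<inter> M b \<subseteq> M d \<or> M d \<inter> M b \<subseteq> M c"
    using assms unfolding chain_traces_def by blast
  then show "(M c - Z) \<inter> (M b - Z) \<subseteq> M d - Z \<or> (M d - Z) \<inter> (M b - Z) \<subseteq> M c - Z" by blast
qed

text \<open>
  A description of the family \<open>M\<close> on the ground set \<open>A\<close>. Each member \<open>f\<close> has a private part
  \<open>X f\<close>, an interval of the order given by \<open>\<sigma>\<close>. The rest of \<open>M f\<close>, if there is any, is
  governed by an earlier member \<open>g = the (p f)\<close>: outside \<open>X g\<close> it agrees with \<open>M g\<close>, and inside
  \<open>X g\<close> it is an initial segment of the order given by \<open>\<tau>\<close>. The rank \<open>r\<close> makes the references
  well-founded. When a description is extended to a larger family, chain traces are applied to \<open>M f\<close>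
  and \<open>M g\<close>; this is why they are required to be incomparable and to meet in \<open>X g\<close>.
\<close>

definition described_by ::
  "'a set \<Rightarrow> 'b set \<Rightarrow> ('b \<Rightarrow> 'a set) \<Rightarrow> ('a \<Rightarrow> nat) \<Rightarrow> ('a \<Rightarrow> nat) \<Rightarrow> ('b \<Rightarrow> 'a set) \<Rightarrow>
   ('b \<Rightarrow> 'b option) \<Rightarrow> ('b \<Rightarrow> nat) \<Rightarrow> bool" where
  "described_by A B M \<sigma> \<tau> X p r \<longleftrightarrow>
     (\<forall>f\<in>B. X f \<subseteq> M f \<and> (\<exists>l u. X f = {x\<in>A. l \<le> \<sigma> x \<and> \<sigma> x < u}) \<and> (p f = None \<longrightarrow> M f = X f)) \<and>
     (\<forall>f\<in>B. \<forall>g. p f = Some g \<longrightarrow>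
        g \<in> B \<and> r g < r f \<and> M f \<inter> X g \<noteq> {} \<and> \<not> M f \<subseteq> M g \<and> \<not> M g \<subseteq> M f \<and>
        M f = X f \<union> (M g - X g) \<union> (X g \<inter> M f) \<and>
        (\<forall>x \<in> X g \<inter> M f. \<forall>y \<in> X g - M f. \<tau> x < \<tau> y))"

lemma described_byD:
  assumes "described_by A B M \<sigma> \<tau> X p r" "f \<in> B"
  shows "X f \<subseteq> M f" "\<exists>l u. X f = {x\<in>A. l \<le> \<sigma> x \<and> \<sigma> x < u}" "p f = None \<Longrightarrow> M f = X f"
    and "p f = Some g \<Longrightarrow> g \<in> B" "p f = Some g \<Longrightarrow> r g < r f" "p f = Some g \<Longrightarrow> M f \<inter> X g \<noteq> {}"
      "p f = Some g \<Longrightarrow> \<not> M f \<subseteq> M g" "p f = Some g \<Longrightarrow> \<not> M g \<subseteq> M f"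
      "p f = Some g \<Longrightarrow> M f = X f \<union> (M g - X g) \<union> (X g \<inter> M f)"
      "p f = Some g \<Longrightarrow> x \<in> X g \<Longrightarrow> x \<in> M f \<Longrightarrow> y \<in> X g \<Longrightarrow> y \<notin> M f \<Longrightarrow> \<tau> x < \<tau> y"
proof -
  show "X f \<subseteq> M f" "\<exists>l u. X f = {x\<in>A. l \<le> \<sigma> x \<and> \<sigma> x < u}" "p f = None \<Longrightarrow> M f = X f"
    using assms unfolding described_by_def by simp_all
  assume pf: "p f = Some g"
  from assms have "g \<in> B \<and> r g < r f \<and> M f \<inter> X g \<noteq> {} \<and> \<not> M f \<subseteq> M g \<and> \<not> M g \<subseteq> M f \<and>
        M f = X f \<union> (M g - X g) \<union> (X g \<inter> M f) \<and>
        (\<forall>x \<in> X g \<inter> M f. \<forall>y \<in> X g - M f. \<tau> x < \<tau> y)" (is "?P1 \<and> ?P2 \<and> ?P3 \<and> ?P4 \<and> ?P5 \<and> ?P6 \<and> ?P7")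
    unfolding described_by_def using pf by meson
  then show ?P1 ?P2 ?P3 ?P4 ?P5 ?P6 "x \<in> X g \<Longrightarrow> x \<in> M f \<Longrightarrow> y \<in> X g \<Longrightarrow> y \<notin> M f \<Longrightarrow> \<tau> x < \<tau> y"
    by blast+
qed

text \<open>
  Induction on the number of sets, splitting off a set \<open>h\<close> of maximum size. Sets inside \<open>h\<close>
  and sets not inside \<open>h\<close> are described on the disjoint ground sets \<open>M h\<close> and \<open>A - M h\<close>, and the
  two descriptions are glued. A set \<open>f\<close> not inside \<open>h\<close> must still be told apart on \<open>M h\<close>. If its
  description refers to some \<open>g\<close>, then \<open>f\<close> and \<open>g\<close> meet outside \<open>h\<close>, and comparing the traces of
  \<open>h\<close> and \<open>g\<close> on \<open>f\<close>, and of \<open>h\<close> and \<open>f\<close> on \<open>g\<close>, shows that \<open>f\<close> and \<open>g\<close> agree on \<open>M h\<close>.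
  Otherwise \<open>f\<close> may refer to \<open>h\<close>.
\<close>

lemma chain_traces_described:
  fixes M :: "'b \<Rightarrow> 'a set"
  assumes "finite B" "finite A" "\<And>f. f \<in> B \<Longrightarrow> M f \<subseteq> A" "chain_traces B M"
  shows "\<exists>\<sigma> \<tau> X p r. described_by A B M \<sigma> \<tau> X p r"
  using assms
proof (induction "card B" arbitrary: A B M rule: less_induct)
  case less
  show ?case
  proof (cases "B = {}")
    case True
    then have "described_by A B M (\<lambda>_. 0) (\<lambda>_. 0) (\<lambda>_. {}) (\<lambda>_. None) (\<lambda>_. 0)"
      by (simp add: described_by_def)
    then show ?thesis by blast
  next
    case False
    define k where "k = Max ((\<lambda>f. card (M f)) ` B)"
    have "k \<in> (\<lambda>f. card (M f)) ` B"
      unfolding k_def using False less.prems(1) by (intro Max_in) auto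
    then obtain h where h: "h \<in> B" "card (M h) = k" by auto
    have h_max: "card (M f) \<le> card (M h)" if "f \<in> B" for f
      unfolding h k_def using that less.prems(1) by auto
    define Bi where "Bi = {f \<in> B - {h}. M f \<subseteq> M h}"
    define Bo where "Bo = {f \<in> B. \<not> M f \<subseteq> M h}"
    have B: "B = insert h (Bi \<union> Bo)" and disj: "h \<notin> Bi" "h \<notin> Bo" "Bi \<inter> Bo = {}"
      using h unfolding Bi_def Bo_def by auto
    have inB: "\<And>f. f \<in> Bi \<Longrightarrow> f \<in> B" "\<And>f. f \<in> Bo \<Longrightarrow> f \<in> B"
      unfolding Bi_def Bo_def by auto
    have Bi: "M f \<subseteq> M h" if "f \<in> Bi" for f using that unfolding Bi_def by auto
    have Bo: "\<not> M f \<subseteq> M h" if "f \<in> Bo" for f using that unfolding Bo_def by auto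
    have fin: "finite Bi" "finite Bo" "finite (M h)" "finite (A - M h)"
      using less.prems(1,2) finite_subset[OF less.prems(3)[OF h(1)]] by (simp_all add: Bi_def Bo_def)
    have h_not_sub: "\<not> M h \<subseteq> M f" if "f \<in> Bo" for f
    proof
      assume "M h \<subseteq> M f"
      moreover have "finite (M f)" "card (M f) \<le> card (M h)"
        using that finite_subset[OF less.prems(3)[of f] less.prems(2)] h_max[of f] by (simp_all add: Bo_def)
      ultimately have "M h = M f" by (metis card_seteq)
      then show False using that by (auto simp: Bo_def)
    qed
    have "Bi \<subset> B" "Bo \<subset> B" using h unfolding Bi_def Bo_def by auto
    then have "card Bi < card B" "card Bo < card B"
      using less.prems(1) by (simp_all add: psubset_card_mono)
    note IH = less.hyps[OF this(1) fin(1,3)] less.hyps[OF this(2) fin(2,4)]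
    have "chain_traces Bi (\<lambda>b. M b - {})" "chain_traces Bo (\<lambda>b. M b - M h)"
      using chain_traces_diff[OF less.prems(4)] B by blast+
    then have ex: "\<exists>\<sigma> \<tau> X p r. described_by (M h) Bi M \<sigma> \<tau> X p r"
      "\<exists>\<sigma> \<tau> X p r. described_by (A - M h) Bo (\<lambda>f. M f - M h) \<sigma> \<tau> X p r"
      using less.prems(3) by (intro IH; force simp: Bi_def Bo_def)+
    then obtain \<sigma>1 \<tau>1 X1 p1 r1 \<sigma>2 \<tau>2 X2 p2 r2 where
      D1: "described_by (M h) Bi M \<sigma>1 \<tau>1 X1 p1 r1" and
      D2: "described_by (A - M h) Bo (\<lambda>f. M f - M h) \<sigma>2 \<tau>2 X2 p2 r2"
      by blast
    \<comment> \<open>The traces of the sets in \<open>Bo\<close> on \<open>M h\<close> form a chain; \<open>\<kappa>\<close> numbers its levels from the top.\<close>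
    define \<kappa> where "\<kappa> x = card {f \<in> Bo. x \<notin> M f}" for x
    define N where "N = Suc (Max (insert 0 (\<sigma>1 ` M h \<union> \<tau>1 ` M h)))"
    have N: "\<sigma>1 x < N" "\<tau>1 x < N" if "x \<in> M h" for x
      using that fin by (auto simp: N_def less_Suc_eq_le intro!: Max_ge)
    define \<sigma> where "\<sigma> x = (if x \<in> M h then \<sigma>1 x else \<sigma>2 x + N)" for x
    \<comment> \<open>On \<open>M h\<close> this is the lexicographic order of \<open>\<kappa>\<close> and \<open>\<tau>1\<close>: each cut of some \<open>X g\<close> with \<open>g\<close> inside \<open>h\<close>
      is compatible with \<open>\<kappa>\<close>, because both come from traces on \<open>M g\<close>.\<close>
    define \<tau> where "\<tau> x = (if x \<in> M h then \<kappa> x * N + \<tau>1 x else \<tau>2 x)" for x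
    define X where "X f = (if f = h then M h else if f \<in> Bi then X1 f else X2 f)" for f
    define p where "p f = (if f = h then None else if f \<in> Bi then p1 f
        else case p2 f of None \<Rightarrow> if M f \<inter> M h = {} then None else Some h | Some g \<Rightarrow> Some g)" for f
    define r where "r f = (if f = h then 0 else if f \<in> Bi then Suc (r1 f) else Suc (r2 f))" for f
    have sub: "M f \<subseteq> A" if "f \<in> B" for f using that less.prems(3) by blast
    have interval: "\<exists>l u. X f = {x\<in>A. l \<le> \<sigma> x \<and> \<sigma> x < u}" if f: "f \<in> B" for f
    proof -
      consider "f = h" | "f \<in> Bi" | "f \<in> Bo" using f B by blast
      then show ?thesis
      proof cases
        case 1
        have "X f = {x\<in>A. 0 \<le> \<sigma> x \<and> \<sigma> x < N}"
          using 1 N(1) sub[OF h(1)] by (auto simp: X_def \<sigma>_def split: if_splits)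
        then show ?thesis by blast
      next
        case 2
        then obtain l u where "X1 f = {x \<in> M h. l \<le> \<sigma>1 x \<and> \<sigma>1 x < u}"
          using described_byD(2)[OF D1] by blast
        then have "X f = {x\<in>A. l \<le> \<sigma> x \<and> \<sigma> x < min u N}"
          using 2 disj N(1) sub[OF h(1)] by (auto simp: X_def \<sigma>_def split: if_splits)
        then show ?thesis by blast
      next
        case 3
        then obtain l u where X2: "X2 f = {x \<in> A - M h. l \<le> \<sigma>2 x \<and> \<sigma>2 x < u}"
          using described_byD(2)[OF D2] by blast
        have no: "\<not> l + N \<le> \<sigma>1 x" if "x \<in> M h" for x
          using N(1)[OF that] by linarith
        have "X f = {x\<in>A. l + N \<le> \<sigma> x \<and> \<sigma> x < u + N}"
          using X2 3 disj no by (auto simp: X_def \<sigma>_def split: if_splits)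
        then show ?thesis by blast
      qed
    qed
    have own: "X f \<subseteq> M f" if "f \<in> B" for f
      using that B disj described_byD(1)[OF D1, of f] described_byD(1)[OF D2, of f] by (auto simp: X_def)
    have root: "M f = X f" if "f \<in> B" "p f = None" for f
      using that B disj described_byD(3)[OF D1, of f] described_byD(3)[OF D2, of f]
      by (auto simp: X_def p_def split: option.splits if_splits)
    have ptr: "g \<in> B \<and> r g < r f \<and> M f \<inter> X g \<noteq> {} \<and> \<not> M f \<subseteq> M g \<and> \<not> M g \<subseteq> M f \<and>
        M f = X f \<union> (M g - X g) \<union> (X g \<inter> M f) \<and>
        (\<forall>x \<in> X g \<inter> M f. \<forall>y \<in> X g - M f. \<tau> x < \<tau> y)"
      if f: "f \<in> B" and pf: "p f = Some g" for f g
    proof -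
      consider "f \<in> Bi" "p1 f = Some g" | "f \<in> Bo" "p2 f = Some g" | "f \<in> Bo" "p2 f = None" "g = h" "M f \<inter> M h \<noteq> {}"
        using f pf B disj by (auto simp: p_def split: if_splits option.splits)
      then show ?thesis
      proof cases
        case 1
        note d = described_byD(1-3)[OF D1 1(1)] described_byD(4-)[OF D1 1]
        have g: "g \<in> Bi" "g \<noteq> h" "f \<noteq> h" using d disj 1 by auto
        have eqs: "X g = X1 g" "X f = X1 f" "r g = Suc (r1 g)" "r f = Suc (r1 f)"
          using g 1 by (auto simp: X_def r_def)
        have Xg: "X g \<subseteq> M g" "M g \<subseteq> M h" using own[of g] g inB Bi[OF g(1)] by auto
        have "\<tau> x < \<tau> y" if x: "x \<in> X g" "x \<in> M f" and y: "y \<in> X g" "y \<notin> M f" for x y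
        proof -
          have "{f' \<in> Bo. x \<notin> M f'} \<subseteq> {f' \<in> Bo. y \<notin> M f'}"
          proof safe
            fix f' assume f': "f' \<in> Bo" "x \<notin> M f'" "y \<in> M f'"
            then have "\<not> M f' \<subseteq> M g" using Xg Bo[of f'] by auto
            then have "y \<in> M f"
              using chain_tracesD[OF less.prems(4), of g f f' x y] f' x y d(7) f g inB Xg by auto
            then show False using y by blast
          qed
          then have "\<kappa> x \<le> \<kappa> y" unfolding \<kappa>_def using fin by (intro card_mono) auto
          moreover have "\<tau>1 x < \<tau>1 y" using d(10) x y eqs by auto
          ultimately have "\<kappa> x * N + \<tau>1 x < \<kappa> y * N + \<tau>1 y"
            by (meson add_le_less_mono mult_le_mono1)
          then show ?thesis using x y Xg by (auto simp: \<tau>_def)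
        qed
        then show ?thesis using d g eqs inB by auto
      next
        case 2
        note d = described_byD(1-3)[OF D2 2(1)] described_byD(4-)[OF D2 2]
        have g: "g \<in> Bo" "g \<noteq> h" "f \<noteq> h" "g \<notin> Bi" "f \<notin> Bi" using d disj 2 by auto
        have eqs: "X g = X2 g" "X f = X2 f" "r g = Suc (r2 g)" "r f = Suc (r2 f)"
          using g 2 by (auto simp: X_def r_def)
        have Xg: "X g \<subseteq> M g - M h" using described_byD(1)[OF D2 g(1)] eqs by auto
        have inc: "\<not> M f \<subseteq> M g" "\<not> M g \<subseteq> M f" using d(7,8) by auto
        \<comment> \<open>A common point outside \<open>M h\<close> rules out that the trace of \<open>g\<close> on \<open>f\<close> lies in that of \<open>h\<close>.\<close>
        obtain z where z: "z \<in> M f" "z \<in> M g" "z \<notin> M h" using d(6) Xg eqs by auto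
        have "y \<in> M g" if "y \<in> M f" "y \<in> M h" for y
          using chain_tracesD[OF less.prems(4), of f g h z y] that z inc h_not_sub[OF 2(1)] f g inB h(1) by blast
        moreover have "y \<in> M f" if "y \<in> M g" "y \<in> M h" for y
          using chain_tracesD[OF less.prems(4), of g f h z y] that z inc h_not_sub[OF g(1)] f g inB h(1) by blast
        ultimately have eq: "M f \<inter> M h = M g \<inter> M h" by blast
        have "M f - M h = X f \<union> (M g - M h - X g) \<union> (X g \<inter> (M f - M h))"
          using d(9) eqs by auto
        then have "M f = X f \<union> (M g - X g) \<union> (X g \<inter> M f)"
          using eq Xg by blast
        moreover have "\<tau> x < \<tau> y" if x: "x \<in> X g" "x \<in> M f" and y: "y \<in> X g" "y \<notin> M f" for x y
          using d(10)[of x y] x y Xg eqs by (auto simp: \<tau>_def)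
        ultimately show ?thesis using d g eqs inB inc z Xg by auto
      next
        case 3
        have ne: "f \<noteq> h" "f \<notin> Bi" using 3 disj by auto
        have "M f - M h = X f" using described_byD(3)[OF D2 3(1,2)] ne by (simp add: X_def)
        moreover have "X h = M h" by (simp add: X_def)
        moreover have "\<tau> x < \<tau> y" if x: "x \<in> M h" "x \<in> M f" and y: "y \<in> M h" "y \<notin> M f" for x y
        proof -
          have "{f' \<in> Bo. x \<notin> M f'} \<subset> {f' \<in> Bo. y \<notin> M f'}"
          proof (intro psubsetI subsetI)
            fix f' assume f': "f' \<in> {f' \<in> Bo. x \<notin> M f'}"
            show "f' \<in> {f' \<in> Bo. y \<notin> M f'}"
              using chain_tracesD[OF less.prems(4) h(1), of f f' x y] f' x y 3(1) Bo inB by auto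
          qed (use 3(1) x y in blast)
          then have "\<kappa> x < \<kappa> y" unfolding \<kappa>_def using fin by (intro psubset_card_mono) auto
          then have "\<kappa> x * N + N \<le> \<kappa> y * N"
            by (metis Suc_leI add.commute mult_Suc mult_le_mono1)
          then show ?thesis using x y N(2)[of x] by (auto simp: \<tau>_def)
        qed
        ultimately show ?thesis using 3 h ne h_not_sub[OF 3(1)]
          Bo[OF 3(1)] by (auto simp: r_def)
      qed
    qed
    have "described_by A B M \<sigma> \<tau> X p r"
      unfolding described_by_def
    proof (rule conjI)
      show "\<forall>f\<in>B. X f \<subseteq> M f \<and> (\<exists>l u. X f = {x\<in>A. l \<le> \<sigma> x \<and> \<sigma> x < u}) \<and> (p f = None \<longrightarrow> M f = X f)"
        by (intro ballI conjI impI own interval root)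
    qed (intro ballI allI impI ptr)
    then show ?thesis by blast
  qed
qed

section \<open>Counting families with chain traces\<close>

lemma card_le_card_codes:
  assumes "finite C" "\<And>x. x \<in> S \<Longrightarrow> \<exists>c\<in>C. R c x" "\<And>c x y. x \<in> S \<Longrightarrow> y \<in> S \<Longrightarrow> R c x \<Longrightarrow> R c y \<Longrightarrow> x = y"
  shows "card S \<le> card C"
proof -
  obtain f where f: "\<And>x. x \<in> S \<Longrightarrow> f x \<in> C \<and> R (f x) x" using assms(2) by metis
  have "inj_on f S" using f assms(3) by (metis inj_onI)
  then show ?thesis using f assms(1) by (intro card_inj_on_le[of f]) auto
qed

text \<open>
  Replacing values by the number of smaller values preserves all comparisons with
  thresholds, so the unbounded orders of a description can be taken with values at most \<open>card A\<close>.
\<close>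

lemma card_below_le_iff:
  fixes s :: "'a \<Rightarrow> nat"
  assumes "finite A" "x \<in> A"
  shows "card {y\<in>A. s y < l} \<le> card {y\<in>A. s y < s x} \<longleftrightarrow> l \<le> s x"
proof
  assume "l \<le> s x"
  then show "card {y\<in>A. s y < l} \<le> card {y\<in>A. s y < s x}"
    using assms by (intro card_mono) auto
next
  assume le: "card {y\<in>A. s y < l} \<le> card {y\<in>A. s y < s x}"
  show "l \<le> s x"
  proof (rule ccontr)
    assume "\<not> l \<le> s x"
    then have "{y\<in>A. s y < s x} \<subseteq> {y\<in>A. s y < l}" "x \<in> {y\<in>A. s y < l} - {y\<in>A. s y < s x}"
      using assms(2) by auto
    then have "{y\<in>A. s y < s x} \<subset> {y\<in>A. s y < l}" by blast
    then have "card {y\<in>A. s y < s x} < card {y\<in>A. s y < l}"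
      using assms(1) by (simp add: psubset_card_mono)
    then show False using le by simp
  qed
qed

lemma card_below_less_iff:
  fixes s :: "'a \<Rightarrow> nat"
  assumes "finite A" "x \<in> A"
  shows "card {y\<in>A. s y < s x} < card {y\<in>A. s y < l} \<longleftrightarrow> s x < l"
  using card_below_le_iff[OF assms, of s l] by linarith

definition nbrs :: "('a \<times> 'b) set \<Rightarrow> 'b \<Rightarrow> 'a set" where
  "nbrs E b = {a. (a, b) \<in> E}"

lemma in_nbrs [simp]: "a \<in> nbrs E b \<longleftrightarrow> (a, b) \<in> E"
  by (simp add: nbrs_def)

definition chain_relations :: "'a set \<Rightarrow> 'b set \<Rightarrow> ('a \<times> 'b) set set" where
  "chain_relations A B = {E. E \<subseteq> A \<times> B \<and> chain_traces B (nbrs E)}"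

text \<open>
  A code is a description in which the private parts and the initial segments are given by
  thresholds. The order of the components is \<open>\<sigma>\<close>, \<open>\<tau>\<close>, the lower and upper ends of the private
  intervals, the thresholds of the initial segments, the ranks, and the references.
\<close>

fun decodes :: "'a set \<Rightarrow> 'b set \<Rightarrow>
    ('a \<Rightarrow> nat) \<times> ('a \<Rightarrow> nat) \<times> ('b \<Rightarrow> nat) \<times> ('b \<Rightarrow> nat) \<times> ('b \<Rightarrow> nat) \<times> ('b \<Rightarrow> nat) \<times> ('b \<Rightarrow> 'b option) \<Rightarrow>
    ('b \<Rightarrow> 'a set) \<Rightarrow> bool" where
  "decodes A B (\<sigma>, \<tau>, l, u, t, r, p) M \<longleftrightarrow>
     (\<forall>f\<in>B. case p f of
        None \<Rightarrow> M f = {x\<in>A. l f \<le> \<sigma> x \<and> \<sigma> x < u f}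
      | Some g \<Rightarrow> g \<in> B \<and> r g < r f \<and>
          M f = {x\<in>A. l f \<le> \<sigma> x \<and> \<sigma> x < u f} \<union> (M g - {x\<in>A. l g \<le> \<sigma> x \<and> \<sigma> x < u g}) \<union>
            {x\<in>A. l g \<le> \<sigma> x \<and> \<sigma> x < u g \<and> \<tau> x < t f})"

lemma decodes_unique:
  assumes "decodes A B c M" "decodes A B c M'" "f \<in> B"
  shows "M f = M' f"
proof -
  obtain \<sigma> \<tau> l u t r p where c: "c = (\<sigma>, \<tau>, l, u, t, r, p)" by (cases c)
  show ?thesis using assms(3)
  proof (induction "r f" arbitrary: f rule: less_induct)
    case less
    show ?case
    proof (cases "p f")
      case None
      then show ?thesis using assms(1,2) less.prems unfolding c by fastforce
    next
      case (Some g)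
      then have "g \<in> B" "r g < r f" using assms(1) less.prems unfolding c by fastforce+
      then have "M g = M' g" by (intro less.hyps)
      moreover have "M f = {x\<in>A. l f \<le> \<sigma> x \<and> \<sigma> x < u f} \<union> (M g - {x\<in>A. l g \<le> \<sigma> x \<and> \<sigma> x < u g}) \<union>
            {x\<in>A. l g \<le> \<sigma> x \<and> \<sigma> x < u g \<and> \<tau> x < t f}"
        using bspec[OF assms(1)[unfolded c decodes.simps] less.prems] Some by simp
      moreover have "M' f = {x\<in>A. l f \<le> \<sigma> x \<and> \<sigma> x < u f} \<union> (M' g - {x\<in>A. l g \<le> \<sigma> x \<and> \<sigma> x < u g}) \<union>
            {x\<in>A. l g \<le> \<sigma> x \<and> \<sigma> x < u g \<and> \<tau> x < t f}"
        using bspec[OF assms(2)[unfolded c decodes.simps] less.prems] Some by simp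
      ultimately show ?thesis by simp
    qed
  qed
qed

lemma chain_traces_coded:
  fixes A :: "'a set" and B :: "'b set"
  assumes fin: "finite A" "finite B" and sub: "\<And>f. f \<in> B \<Longrightarrow> M f \<subseteq> A" and chain: "chain_traces B M"
    and K: "card A + card B < K"
  shows "\<exists>c \<in> (A \<rightarrow>\<^sub>E {..<K}) \<times> (A \<rightarrow>\<^sub>E {..<K}) \<times> (B \<rightarrow>\<^sub>E {..<K}) \<times> (B \<rightarrow>\<^sub>E {..<K}) \<times> (B \<rightarrow>\<^sub>E {..<K}) \<times>
      (B \<rightarrow>\<^sub>E {..<K}) \<times> (B \<rightarrow>\<^sub>E insert None (Some ` B)). decodes A B c M"
proof -
  obtain \<sigma> \<tau> X p r where D: "described_by A B M \<sigma> \<tau> X p r"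
    using chain_traces_described[OF fin(2,1) sub chain] by blast
  obtain l u where X: "\<And>f. f \<in> B \<Longrightarrow> X f = {x\<in>A. l f \<le> \<sigma> x \<and> \<sigma> x < u f}"
    using described_byD(2)[OF D] by metis
  \<comment> \<open>The smallest threshold above all points of \<open>X g\<close> that belong to \<open>M f\<close>.\<close>
  define t where "t f = (case p f of None \<Rightarrow> 0 | Some g \<Rightarrow> Suc (Max (\<tau> ` (X g \<inter> M f))))" for f
  have t: "X g \<inter> M f = {x \<in> X g. \<tau> x < t f}" if f: "f \<in> B" "p f = Some g" for f g
  proof -
    let ?T = "\<tau> ` (X g \<inter> M f)"
    have ne: "finite ?T" "?T \<noteq> {}"
      using described_byD(6)[OF D f] finite_subset[OF sub fin(1)] f(1) by blast+
    have "x \<in> M f" if x: "x \<in> X g" "\<tau> x \<le> Max ?T" for x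
    proof (rule ccontr)
      assume "x \<notin> M f"
      moreover obtain z where "z \<in> X g \<inter> M f" "\<tau> z = Max ?T" using Max_in[OF ne] by force
      ultimately show False using described_byD(10)[OF D f, of z x] x by auto
    qed
    moreover have "\<tau> x \<le> Max ?T" if "x \<in> X g" "x \<in> M f" for x
      using that ne by (intro Max_ge) auto
    ultimately show ?thesis using f(2) by (auto simp: t_def less_Suc_eq_le)
  qed
  define rk where "rk s v = card {y\<in>A. s y < v}" for s :: "'a \<Rightarrow> nat" and v :: nat
  define rkB where "rkB v = card {g\<in>B. r g < v}" for v :: nat
  have bound: "rk s v < K" "rkB v < K" for s v
    using K card_mono[OF fin(1), of "{y\<in>A. s y < v}"] card_mono[OF fin(2), of "{g\<in>B. r g < v}"]
    unfolding rk_def rkB_def by auto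
  have rk: "rk s v \<le> rk s (s x) \<longleftrightarrow> v \<le> s x" "rk s (s x) < rk s v \<longleftrightarrow> s x < v" if "x \<in> A" for s v x
    unfolding rk_def using card_below_le_iff[OF fin(1) that] card_below_less_iff[OF fin(1) that] by auto
  have rkB: "rkB (r g) < rkB (r f) \<longleftrightarrow> r g < r f" if "g \<in> B" for g f
    unfolding rkB_def using card_below_less_iff[OF fin(2) that] .
  define c where "c = (\<lambda>x\<in>A. rk \<sigma> (\<sigma> x), \<lambda>x\<in>A. rk \<tau> (\<tau> x), \<lambda>f\<in>B. rk \<sigma> (l f), \<lambda>f\<in>B. rk \<sigma> (u f),
      \<lambda>f\<in>B. rk \<tau> (t f), \<lambda>f\<in>B. rkB (r f), restrict p B)"
  have Xrk: "{x\<in>A. (\<lambda>f\<in>B. rk \<sigma> (l f)) f \<le> (\<lambda>x\<in>A. rk \<sigma> (\<sigma> x)) x \<and> (\<lambda>x\<in>A. rk \<sigma> (\<sigma> x)) x < (\<lambda>f\<in>B. rk \<sigma> (u f)) f} = X f"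
    if "f \<in> B" for f using that X rk by auto
  have Xtrk: "{x\<in>A. (\<lambda>f\<in>B. rk \<sigma> (l f)) g \<le> (\<lambda>x\<in>A. rk \<sigma> (\<sigma> x)) x \<and> (\<lambda>x\<in>A. rk \<sigma> (\<sigma> x)) x < (\<lambda>f\<in>B. rk \<sigma> (u f)) g \<and>
      (\<lambda>x\<in>A. rk \<tau> (\<tau> x)) x < (\<lambda>f\<in>B. rk \<tau> (t f)) f} = X g \<inter> M f"
    if "f \<in> B" "p f = Some g" "g \<in> B" for f g using that X rk t[OF that(1,2)] by auto
  have "decodes A B c M"
    unfolding c_def decodes.simps
  proof
    fix f assume f: "f \<in> B"
    show "case restrict p B f of
        None \<Rightarrow> M f = {x\<in>A. (\<lambda>f\<in>B. rk \<sigma> (l f)) f \<le> (\<lambda>x\<in>A. rk \<sigma> (\<sigma> x)) x \<and> (\<lambda>x\<in>A. rk \<sigma> (\<sigma> x)) x < (\<lambda>f\<in>B. rk \<sigma> (u f)) f}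
      | Some g \<Rightarrow> g \<in> B \<and> (\<lambda>f\<in>B. rkB (r f)) g < (\<lambda>f\<in>B. rkB (r f)) f \<and>
          M f = {x\<in>A. (\<lambda>f\<in>B. rk \<sigma> (l f)) f \<le> (\<lambda>x\<in>A. rk \<sigma> (\<sigma> x)) x \<and> (\<lambda>x\<in>A. rk \<sigma> (\<sigma> x)) x < (\<lambda>f\<in>B. rk \<sigma> (u f)) f} \<union>
            (M g - {x\<in>A. (\<lambda>f\<in>B. rk \<sigma> (l f)) g \<le> (\<lambda>x\<in>A. rk \<sigma> (\<sigma> x)) x \<and> (\<lambda>x\<in>A. rk \<sigma> (\<sigma> x)) x < (\<lambda>f\<in>B. rk \<sigma> (u f)) g}) \<union>
            {x\<in>A. (\<lambda>f\<in>B. rk \<sigma> (l f)) g \<le> (\<lambda>x\<in>A. rk \<sigma> (\<sigma> x)) x \<and> (\<lambda>x\<in>A. rk \<sigma> (\<sigma> x)) x < (\<lambda>f\<in>B. rk \<sigma> (u f)) g \<and>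
              (\<lambda>x\<in>A. rk \<tau> (\<tau> x)) x < (\<lambda>f\<in>B. rk \<tau> (t f)) f}"
    proof (cases "p f")
      case None
      then show ?thesis using Xrk[OF f] described_byD(3)[OF D f None] f by simp
    next
      case (Some g)
      note d = described_byD(4,5,9)[OF D f Some]
      show ?thesis
        unfolding Xrk[OF f]
        using Xrk[OF d(1)] Xtrk[OF f Some d(1)] d rkB[OF d(1)] f Some by simp
    qed
  qed
  moreover have "p f \<in> insert None (Some ` B)" if "f \<in> B" for f
    using described_byD(4)[OF D that] by (cases "p f") auto
  then have "c \<in> (A \<rightarrow>\<^sub>E {..<K}) \<times> (A \<rightarrow>\<^sub>E {..<K}) \<times> (B \<rightarrow>\<^sub>E {..<K}) \<times> (B \<rightarrow>\<^sub>E {..<K}) \<times> (B \<rightarrow>\<^sub>E {..<K}) \<times>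
      (B \<rightarrow>\<^sub>E {..<K}) \<times> (B \<rightarrow>\<^sub>E insert None (Some ` B))"
    unfolding c_def using bound by (auto intro!: restrict_PiE)
  ultimately show ?thesis by blast
qed

text \<open>
  There are two numbers for each point of \<open>A\<close> and five for each set.
\<close>

lemma card_chain_relations_le:
  assumes fin: "finite A" "finite B" and K: "card A + card B < K"
  shows "card (chain_relations A B) \<le> K ^ (5 * (card A + card B))"
proof -
  let ?C = "(A \<rightarrow>\<^sub>E {..<K}) \<times> (A \<rightarrow>\<^sub>E {..<K}) \<times> (B \<rightarrow>\<^sub>E {..<K}) \<times> (B \<rightarrow>\<^sub>E {..<K}) \<times> (B \<rightarrow>\<^sub>E {..<K}) \<times>
      (B \<rightarrow>\<^sub>E {..<K}) \<times> (B \<rightarrow>\<^sub>E insert None (Some ` B))"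
  have finite: "finite ?C" using fin by (intro finite_cartesian_product finite_PiE) auto
  have "card (chain_relations A B) \<le> card ?C"
  proof (rule card_le_card_codes[where R = "\<lambda>c E. decodes A B c (nbrs E)", OF finite])
    fix E assume "E \<in> chain_relations A B"
    then show "\<exists>c\<in>?C. decodes A B c (nbrs E)"
      by (intro chain_traces_coded fin K) (auto simp: chain_relations_def nbrs_def)
  next
    fix c E E' assume E: "E \<in> chain_relations A B" "E' \<in> chain_relations A B"
      and c: "decodes A B c (nbrs E)" "decodes A B c (nbrs E')"
    have "(a, b) \<in> E \<longleftrightarrow> (a, b) \<in> E'" for a b
    proof (cases "b \<in> B")
      case True
      then show ?thesis using decodes_unique[OF c True] by (metis in_nbrs)
    next
      case False
      then show ?thesis using E by (auto simp: chain_relations_def)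
    qed
    then show "E = E'" by auto
  qed
  also have "card ?C = K ^ (2 * card A + 4 * card B) * Suc (card B) ^ card B"
  proof -
    have "card (insert None (Some ` B)) = Suc (card B)"
      using fin by (simp add: card_insert_if card_image image_iff)
    moreover have "K ^ (2 * card A + 4 * card B) = K ^ card A * (K ^ card A * (K ^ card B * (K ^ card B * (K ^ card B * K ^ card B))))"
      by (simp add: power_add mult_2 numeral_eq_Suc mult.assoc)
    ultimately show ?thesis
      using fin by (simp add: card_cartesian_product card_PiE mult.assoc)
  qed
  also have "\<dots> \<le> K ^ (2 * card A + 4 * card B) * K ^ card B"
    using K by (intro mult_left_mono power_mono) auto
  also have "\<dots> = K ^ (2 * card A + 5 * card B)" by (simp flip: power_add add: add_ac)
  also have "\<dots> \<le> K ^ (5 * (card A + card B))"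
    using K by (intro power_increasing) auto
  finally show ?thesis .
qed

section \<open>Relations without induced paths and matchings\<close>

text \<open>
  In this relation and the next one the vertices named are automatically distinct and
  incident with \<open>E\<close>. In \<open>P\<^sub>7\<close> the four vertices of the larger colour class lie on the
  left. In \<open>P\<^sub>5 + K\<^sub>2\<close>, too, the left side has four vertices: the two ends and the middle of the path
  and one end of the extra edge; the opposite placement is expressed by the converse relation.
\<close>

definition P7_free :: "('a \<times> 'b) set \<Rightarrow> bool" where
  "P7_free E \<longleftrightarrow> \<not> (\<exists>a1 a2 a3 a4 b1 b2 b3.
     (a1, b1) \<in> E \<and> (a2, b1) \<in> E \<and> (a2, b2) \<in> E \<and> (a3, b2) \<in> E \<and> (a3, b3) \<in> E \<and> (a4, b3) \<in> E \<and>
     (a1, b2) \<notin> E \<and> (a1, b3) \<notin> E \<and> (a2, b3) \<notin> E \<and> (a3, b1) \<notin> E \<and> (a4, b1) \<notin> E \<and> (a4, b2) \<notin> E)"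

definition P5K2_free :: "('a \<times> 'b) set \<Rightarrow> bool" where
  "P5K2_free E \<longleftrightarrow> \<not> (\<exists>a1 a2 a3 a4 b1 b2 b3.
     (a1, b1) \<in> E \<and> (a2, b1) \<in> E \<and> (a2, b2) \<in> E \<and> (a3, b2) \<in> E \<and> (a4, b3) \<in> E \<and>
     (a1, b2) \<notin> E \<and> (a1, b3) \<notin> E \<and> (a2, b3) \<notin> E \<and> (a3, b1) \<notin> E \<and> (a3, b3) \<notin> E \<and>
     (a4, b1) \<notin> E \<and> (a4, b2) \<notin> E)"

lemma P7_freeD:
  assumes "P7_free E" "(a1, b1) \<in> E" "(a2, b1) \<in> E" "(a2, b2) \<in> E" "(a3, b2) \<in> E" "(a3, b3) \<in> E" "(a4, b3) \<in> E"
     "(a1, b2) \<notin> E" "(a1, b3) \<notin> E" "(a2, b3) \<notin> E" "(a3, b1) \<notin> E" "(a4, b1) \<notin> E" "(a4, b2) \<notin> E"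
  shows False
  using assms(1)[unfolded P7_free_def not_ex, rule_format, of a1 b1 a2 b2 a3 b3 a4] assms(2-) by simp

lemma P5K2_freeD:
  assumes "P5K2_free E" "(a1, b1) \<in> E" "(a2, b1) \<in> E" "(a2, b2) \<in> E" "(a3, b2) \<in> E" "(a4, b3) \<in> E"
     "(a1, b2) \<notin> E" "(a1, b3) \<notin> E" "(a2, b3) \<notin> E" "(a3, b1) \<notin> E" "(a3, b3) \<notin> E" "(a4, b1) \<notin> E" "(a4, b2) \<notin> E"
  shows False
  using assms(1)[unfolded P5K2_free_def not_ex, rule_format, of a1 b1 a2 b2 a3 a4 b3] assms(2-) by simp

text \<open>
  An induced matching of three edges \<open>a i\<close> -- \<open>b i\<close>. It is indexed by numbers below \<open>3\<close> so that
  one end can be replaced by a function update.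
\<close>

definition matching3 :: "('a \<times> 'b) set \<Rightarrow> (nat \<Rightarrow> 'a) \<Rightarrow> (nat \<Rightarrow> 'b) \<Rightarrow> bool" where
  "matching3 E a b \<longleftrightarrow> (\<forall>i<3. \<forall>j<3. (a i, b j) \<in> E \<longleftrightarrow> i = j)"

lemma matching3D: "matching3 E a b \<Longrightarrow> i < 3 \<Longrightarrow> j < 3 \<Longrightarrow> (a i, b j) \<in> E \<longleftrightarrow> i = j"
  by (simp add: matching3_def)

lemma matching3_converse [simp]: "matching3 (E\<inverse>) b a \<longleftrightarrow> matching3 E a b"
  unfolding matching3_def by auto

lemma matching3_triple:
  assumes "(a1, b1) \<in> E" "(a2, b2) \<in> E" "(a3, b3) \<in> E" "(a1, b2) \<notin> E" "(a1, b3) \<notin> E" "(a2, b1) \<notin> E"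
    "(a2, b3) \<notin> E" "(a3, b1) \<notin> E" "(a3, b2) \<notin> E"
  shows "\<exists>a b. matching3 E a b"
proof (intro exI)
  show "matching3 E (\<lambda>i. [a1, a2, a3] ! i) (\<lambda>i. [b1, b2, b3] ! i)"
    using assms by (auto simp: matching3_def numeral_3_eq_3 less_Suc_eq)
qed

text \<open>
  Suppose that the non-neighbours of \<open>c\<close> and \<open>d\<close> have incomparable traces on the
  non-neighbours of \<open>b\<close>, witnessed by \<open>y\<close> and \<open>z\<close>, and that \<open>v\<close> and \<open>w\<close> are neighbours of \<open>b\<close>
  not adjacent to \<open>c\<close> and \<open>d\<close>, respectively. Either one of \<open>v\<close> and \<open>w\<close> completes an induced matching
  on \<open>b\<close>, \<open>c\<close>, \<open>d\<close>, or \<open>y d v b w c z\<close> is an induced \<open>P\<^sub>7\<close>.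
\<close>

lemma complement_chain_relation:
  assumes P7: "P7_free E" and no: "\<And>a b. \<not> matching3 E a b"
  shows "A \<times> B - E \<in> chain_relations A B"
proof -
  have "nbrs (A \<times> B - E) c \<inter> nbrs (A \<times> B - E) b \<subseteq> nbrs (A \<times> B - E) d \<or>
      nbrs (A \<times> B - E) d \<inter> nbrs (A \<times> B - E) b \<subseteq> nbrs (A \<times> B - E) c"
    if B: "b \<in> B" "c \<in> B" "d \<in> B" and
      cb: "\<not> nbrs (A \<times> B - E) c \<subseteq> nbrs (A \<times> B - E) b" and db: "\<not> nbrs (A \<times> B - E) d \<subseteq> nbrs (A \<times> B - E) b"
    for b c d
  proof (rule ccontr)
    assume "\<not> ?thesis"
    then obtain y z where y: "(y, c) \<notin> E" "(y, b) \<notin> E" "(y, d) \<in> E" and z: "(z, d) \<notin> E" "(z, b) \<notin> E" "(z, c) \<in> E"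
      using B by auto
    obtain v where v: "(v, c) \<notin> E" "(v, b) \<in> E" using cb B by auto
    obtain w where w: "(w, d) \<notin> E" "(w, b) \<in> E" using db B by auto
    have vd: "(v, d) \<in> E" using matching3_triple[of v b E y d z c] v y z no by blast
    have wc: "(w, c) \<in> E" using matching3_triple[of w b E y d z c] w y z no by blast
    show False by (rule P7_freeD[OF P7, of y d v b w c z]) (use v w y z vd wc in auto)
  qed
  then show ?thesis unfolding chain_relations_def chain_traces_def by blast
qed

section \<open>The module spanned by an induced matching of three edges\<close>

text \<open>
  A vertex that sees exactly one edge of a matching can replace an end of that edge. Closing up
  under these replacements absorbs all such vertices, so that in the absence of \<open>P\<^sub>5 + K\<^sub>2\<close> every
  other vertex sees all or none of the vertices on the opposite side of each matching.
\<close>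

inductive swaps :: "('a \<times> 'b) set \<Rightarrow> (nat \<Rightarrow> 'a) \<Rightarrow> (nat \<Rightarrow> 'b) \<Rightarrow> (nat \<Rightarrow> 'a) \<Rightarrow> (nat \<Rightarrow> 'b) \<Rightarrow> bool"
  for E a0 b0 where
  start: "swaps E a0 b0 a0 b0"
| left: "swaps E a0 b0 a b \<Longrightarrow> i < 3 \<Longrightarrow> matching3 E (a(i := v)) b \<Longrightarrow> swaps E a0 b0 (a(i := v)) b"
| right: "swaps E a0 b0 a b \<Longrightarrow> i < 3 \<Longrightarrow> matching3 E a (b(i := w)) \<Longrightarrow> swaps E a0 b0 a (b(i := w))"

lemma swaps_converse:
  assumes "swaps E a0 b0 a b"
  shows "swaps (E\<inverse>) b0 a0 b a"
  using assms
proof induction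
  case start
  show ?case by (rule swaps.start)
next
  case (left a b i v)
  then show ?case by (intro swaps.right) simp_all
next
  case (right a b i w)
  then show ?case by (intro swaps.left) simp_all
qed

lemma swaps_matching3:
  assumes "swaps E a0 b0 a b" "matching3 E a0 b0"
  shows "matching3 E a b"
  using assms by induction auto

definition swap_span :: "('a \<times> 'b) set \<Rightarrow> (nat \<Rightarrow> 'a) \<Rightarrow> (nat \<Rightarrow> 'b) \<Rightarrow> 'a set" where
  "swap_span E a0 b0 = {a i | a b i. swaps E a0 b0 a b \<and> i < 3}"

lemma swap_spanI: "swaps E a0 b0 a b \<Longrightarrow> i < 3 \<Longrightarrow> a i \<in> swap_span E a0 b0"
  unfolding swap_span_def by blast

lemma swap_span_converse: "swap_span (E\<inverse>) b0 a0 = {b i | a b i. swaps E a0 b0 a b \<and> i < 3}"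
proof -
  have "swaps (E\<inverse>) b0 a0 b a \<longleftrightarrow> swaps E a0 b0 a b" for a b
    using swaps_converse[of E a0 b0 a b] swaps_converse[of "E\<inverse>" b0 a0 b a] by auto
  then show ?thesis unfolding swap_span_def by blast
qed

text \<open>
  If \<open>v\<close> were adjacent to \<open>b i\<close> and \<open>b j\<close> but not to \<open>b k\<close>, then the path
  \<open>a i\<close>, \<open>b i\<close>, \<open>v\<close>, \<open>b j\<close>, \<open>a j\<close> and the edge \<open>a k\<close> -- \<open>b k\<close> would form an induced \<open>P\<^sub>5 + K\<^sub>2\<close>.
\<close>

lemma two_nbrs_imp_all:
  assumes free: "P5K2_free E" and m: "matching3 E a b" and ij: "i < 3" "j < 3" "i \<noteq> j" and k: "k < 3"
    and adj: "(v, b i) \<in> E" "(v, b j) \<in> E"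
  shows "(v, b k) \<in> E"
proof (rule ccontr)
  assume no: "(v, b k) \<notin> E"
  then have "k \<noteq> i" "k \<noteq> j" using adj by auto
  then show False
    using P5K2_freeD[OF free, of "a i" "b i" v "b j" "a j" "a k" "b k"] no adj ij k matching3D[OF m] by auto
qed

text \<open>
  A vertex adjacent to exactly one \<open>b i\<close> could replace \<open>a i\<close>, so it would lie in the span.
\<close>

lemma homogeneous_to_matching:
  assumes free: "P5K2_free E" and m: "matching3 E a0 b0" and s: "swaps E a0 b0 a b"
    and v: "v \<notin> swap_span E a0 b0" and ij: "i < 3" "j < 3" and adj: "(v, b i) \<in> E"
  shows "(v, b j) \<in> E"
proof (rule ccontr)
  assume no: "(v, b j) \<notin> E"
  note m' = swaps_matching3[OF s m]
  have "(v, b k) \<notin> E" if "k < 3" "k \<noteq> i" for k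
    using two_nbrs_imp_all[OF free m' ij(1) that(1) _ ij(2) adj] no that by auto
  then have "matching3 E (a(i := v)) b"
    using m' adj unfolding matching3_def by auto
  then have "swaps E a0 b0 (a(i := v)) b" using s ij by (intro swaps.left)
  then show False using swap_spanI[OF _ ij(1)] v by fastforce
qed

lemma other_index: "\<exists>j<3. j \<noteq> (k::nat) \<and> (\<exists>j'<3. j' \<noteq> k \<and> j' \<noteq> j)"
proof -
  consider "k = 0" | "k = 1" | "k \<noteq> 0 \<and> k \<noteq> 1" by blast
  then show ?thesis
  proof cases
    case 1 then show ?thesis by (intro exI[of _ 1] conjI exI[of _ 2]) auto
  next
    case 2 then show ?thesis by (intro exI[of _ 0] conjI exI[of _ 2]) auto
  next
    case 3 then show ?thesis by (intro exI[of _ 0] conjI exI[of _ 1]) auto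
  qed
qed

text \<open>
  A replacement changes only one of the three vertices on the right. A vertex homogeneous
  to both the old and the new matching sees the two in the same way, since they share two vertices.
\<close>

lemma homogeneous_to_swaps:
  assumes free: "P5K2_free E" and m: "matching3 E a0 b0" and v: "v \<notin> swap_span E a0 b0"
    and s: "swaps E a0 b0 a b" and i: "i < 3"
  shows "(v, b i) \<in> E \<longleftrightarrow> (v, b0 0) \<in> E"
  using s i
proof (induction arbitrary: i)
  case start
  then show ?case using homogeneous_to_matching[OF free m swaps.start v] by (metis zero_less_numeral)
next
  case (left a b k w)
  then show ?case by blast
next
  case (right a b k w)
  obtain j where j: "j < 3" "j \<noteq> k" using other_index by blast
  have "swaps E a0 b0 a (b(k := w))" using right.hyps by (rule swaps.right)
  note h = homogeneous_to_matching[OF free m this v]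
  have "(v, (b(k := w)) i) \<in> E \<longleftrightarrow> (v, (b(k := w)) j) \<in> E"
    using h[of i j] h[of j i] j(1) right.prems by blast
  then show ?case using right.IH[OF j(1)] j(2) by simp
qed

lemma complete_to_swaps:
  assumes free: "P5K2_free E" and m: "matching3 E a0 b0" and s: "swaps E a0 b0 a b"
    and all: "\<And>i. i < 3 \<Longrightarrow> (v, b0 i) \<in> E" and i: "i < 3"
  shows "(v, b i) \<in> E"
  using s i
proof (induction arbitrary: i)
  case start
  then show ?case using all by blast
next
  case (left a b k w)
  then show ?case by blast
next
  case (right a b k w)
  obtain j j' where j: "j < 3" "j \<noteq> k" "j' < 3" "j' \<noteq> k" "j \<noteq> j'" using other_index by metis
  have "(v, (b(k := w)) j) \<in> E" "(v, (b(k := w)) j') \<in> E" using right.IH j by auto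
  then show ?case
    using two_nbrs_imp_all[OF free right.hyps(3) j(1,3,5) right.prems] by blast
qed

text \<open>
  With two neighbours in the original matching, \<open>v\<close> would be complete to its right side, and this
  property survives replacements: two of the three right vertices remain, which
  forces the third. But \<open>v\<close> is itself an end of one of the matchings so obtained.
\<close>

lemma swap_span_one_nbr:
  assumes free: "P5K2_free E" and m: "matching3 E a0 b0" and v: "v \<in> swap_span E a0 b0"
    and ij: "i < 3" "j < 3" and adj: "(v, b0 i) \<in> E" "(v, b0 j) \<in> E"
  shows "i = j"
proof (rule ccontr)
  assume ne: "i \<noteq> j"
  obtain a b k where s: "swaps E a0 b0 a b" and k: "k < 3" "v = a k"
    using v unfolding swap_span_def by blast
  obtain l where l: "l < 3" "l \<noteq> k" using other_index by blast
  have "(v, b l) \<in> E"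
    using complete_to_swaps[OF free m s _ l(1)] two_nbrs_imp_all[OF free m ij ne _ adj] by blast
  then show False using matching3D[OF swaps_matching3[OF s m] k(1) l(1)] k l by auto
qed

lemma laminar_imp_chain_traces:
  assumes "\<And>b c. b \<in> B \<Longrightarrow> c \<in> B \<Longrightarrow> M b \<inter> M c = {} \<or> M b \<subseteq> M c \<or> M c \<subseteq> M b"
  shows "chain_traces B M"
  unfolding chain_traces_def using assms by fast

text \<open>
  On the vertices that miss the edge \<open>(a, b)\<close> there is no induced \<open>P\<^sub>5\<close> with its ends on the left,
  so two neighbourhoods that meet are comparable.
\<close>

lemma missed_edge_chain_relation:
  assumes free: "P5K2_free E" and ab: "(a, b) \<in> E"
  shows "{(x, y) \<in> E. x \<in> X \<and> y \<in> Y \<and> (x, b) \<notin> E \<and> (a, y) \<notin> E} \<in> chain_relations X Y" (is "?F \<in> _")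
proof -
  have "nbrs ?F y \<inter> nbrs ?F y' = {} \<or> nbrs ?F y \<subseteq> nbrs ?F y' \<or> nbrs ?F y' \<subseteq> nbrs ?F y" for y y'
  proof (rule ccontr)
    assume "\<not> ?thesis"
    then obtain x1 x2 x3 where "(x1, y) \<in> ?F" "(x1, y') \<notin> ?F" "(x2, y) \<in> ?F" "(x2, y') \<in> ?F" "(x3, y') \<in> ?F" "(x3, y) \<notin> ?F"
      by (auto simp: nbrs_def)
    then show False
      using P5K2_freeD[OF free, of x1 y x2 y' x3 a b] ab by auto
  qed
  then have "chain_traces Y (nbrs ?F)" by (intro laminar_imp_chain_traces)
  then show ?thesis by (auto simp: chain_relations_def)
qed

text \<open>
  \<open>X\<close> and \<open>Y\<close> are the vertices swept out by the replacements. A vertex of \<open>X\<close> sees at most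
  one \<open>b0 i\<close>, and a vertex of \<open>Y\<close> at most one \<open>a0 i\<close>, so for each pair in \<open>X \<times> Y\<close> one of the three
  indices is left, and the pair misses the corresponding edge of the original matching.
\<close>

lemma matching3_module:
  assumes fin: "finite A" "finite B" and E: "E \<subseteq> A \<times> B" and free: "P5K2_free E" "P5K2_free (E\<inverse>)"
    and m: "matching3 E a0 b0"
  obtains X Y F0 F1 F2 where
    "X \<subseteq> A" "Y \<subseteq> B" "3 \<le> card X" "3 \<le> card Y"
    "\<And>x x' w. x \<in> X \<Longrightarrow> x' \<in> X \<Longrightarrow> w \<in> B - Y \<Longrightarrow> (x, w) \<in> E \<longleftrightarrow> (x', w) \<in> E"
    "\<And>y y' v. y \<in> Y \<Longrightarrow> y' \<in> Y \<Longrightarrow> v \<in> A - X \<Longrightarrow> (v, y) \<in> E \<longleftrightarrow> (v, y') \<in> E"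
    "E \<inter> X \<times> Y = F0 \<union> F1 \<union> F2"
    "F0 \<in> chain_relations X Y" "F1 \<in> chain_relations X Y" "F2 \<in> chain_relations X Y"
proof -
  define X where "X = swap_span E a0 b0"
  define Y where "Y = swap_span (E\<inverse>) b0 a0"
  have mc: "matching3 (E\<inverse>) b0 a0" using m by simp
  have edge: "(a i, b i) \<in> E" if "swaps E a0 b0 a b" "i < 3" for a b i
    using matching3D[OF swaps_matching3[OF that(1) m] that(2,2)] by simp
  have sub: "X \<subseteq> A" "Y \<subseteq> B"
    using edge E unfolding X_def swap_span_def Y_def[unfolded swap_span_converse] by blast+
  have mem: "a0 i \<in> X" "b0 i \<in> Y" if "i < 3" for i
    unfolding X_def Y_def using that by (auto intro!: swap_spanI swaps.start)
  have "inj_on a0 {..<3}" "inj_on b0 {..<3}"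
    using m unfolding matching3_def inj_on_def by (metis lessThan_iff)+
  then have "card (a0 ` {..<3}) = 3" "card (b0 ` {..<3}) = 3" by (simp_all add: card_image)
  moreover have "a0 ` {..<3} \<subseteq> X" "b0 ` {..<3} \<subseteq> Y" using mem by auto
  ultimately have card: "3 \<le> card X" "3 \<le> card Y"
    using card_mono finite_subset[OF sub(1) fin(1)] finite_subset[OF sub(2) fin(2)] by metis+
  have outB: "(v, y) \<in> E \<longleftrightarrow> (v, b0 0) \<in> E" if y: "y \<in> Y" and v: "v \<in> A - X" for v y
  proof -
    obtain a b i where "swaps E a0 b0 a b" "i < 3" "y = b i"
      using y unfolding Y_def swap_span_converse by blast
    then show ?thesis using homogeneous_to_swaps[OF free(1) m] v unfolding X_def by blast
  qed
  have outA: "(x, w) \<in> E \<longleftrightarrow> (a0 0, w) \<in> E" if x: "x \<in> X" and w: "w \<in> B - Y" for x w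
  proof -
    obtain a b i where "swaps E a0 b0 a b" "i < 3" "x = a i"
      using x unfolding X_def swap_span_def by blast
    then have "(w, x) \<in> E\<inverse> \<longleftrightarrow> (w, a0 0) \<in> E\<inverse>"
      using homogeneous_to_swaps[OF free(2) mc _ swaps_converse] w unfolding Y_def by blast
    then show ?thesis by simp
  qed
  define F where "F i = {(x, y) \<in> E. x \<in> X \<and> y \<in> Y \<and> (x, b0 i) \<notin> E \<and> (a0 i, y) \<notin> E}" for i
  have F: "F i \<in> chain_relations X Y" if "i < 3" for i
    unfolding F_def using missed_edge_chain_relation[OF free(1)] matching3D[OF m that that] by simp
  have "E \<inter> X \<times> Y \<subseteq> F 0 \<union> F 1 \<union> F 2"
  proof clarify
    fix x y assume xy: "(x, y) \<in> E" "x \<in> X" "y \<in> Y" "(x, y) \<notin> F 1" "(x, y) \<notin> F 2"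
    have x1: "(x, b0 i) \<in> E \<Longrightarrow> (x, b0 j) \<in> E \<Longrightarrow> i = j" if "i < 3" "j < 3" for i j
      using swap_span_one_nbr[OF free(1) m xy(2)[unfolded X_def] that] .
    have y1: "(a0 i, y) \<in> E \<Longrightarrow> (a0 j, y) \<in> E \<Longrightarrow> i = j" if "i < 3" "j < 3" for i j
      using swap_span_one_nbr[OF free(2) mc xy(3)[unfolded Y_def] that] by simp
    have "(x, b0 1) \<in> E \<or> (a0 1, y) \<in> E" "(x, b0 2) \<in> E \<or> (a0 2, y) \<in> E"
      using xy unfolding F_def by auto
    then have "(x, b0 0) \<notin> E \<and> (a0 0, y) \<notin> E"
      using x1[of 0 1] x1[of 0 2] x1[of 1 2] y1[of 0 1] y1[of 0 2] y1[of 1 2] by auto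
    then show "(x, y) \<in> F 0" using xy unfolding F_def by auto
  qed
  moreover have "F i \<subseteq> E \<inter> X \<times> Y" for i unfolding F_def by auto
  ultimately have "E \<inter> X \<times> Y = F 0 \<union> F 1 \<union> F 2" by blast
  then show thesis
    using that[of X Y "F 0" "F 1" "F 2"] sub card outA outB F by simp
qed

section \<open>Counting the relations\<close>

definition free_relations :: "'a set \<Rightarrow> 'b set \<Rightarrow> ('a \<times> 'b) set set" where
  "free_relations A B = {E. E \<subseteq> A \<times> B \<and> P7_free E \<and> P5K2_free E \<and> P5K2_free (E\<inverse>)}"

lemma P7_free_restrict:
  assumes "P7_free E"
  shows "P7_free (E \<inter> X \<times> Y)"
proof (rule ccontr)
  assume "\<not> P7_free (E \<inter> X \<times> Y)"
  then obtain a1 a2 a3 a4 b1 b2 b3 where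
    "(a1, b1) \<in> E \<inter> X \<times> Y" "(a2, b1) \<in> E \<inter> X \<times> Y" "(a2, b2) \<in> E \<inter> X \<times> Y" "(a3, b2) \<in> E \<inter> X \<times> Y"
    "(a3, b3) \<in> E \<inter> X \<times> Y" "(a4, b3) \<in> E \<inter> X \<times> Y"
    "(a1, b2) \<notin> E \<inter> X \<times> Y" "(a1, b3) \<notin> E \<inter> X \<times> Y" "(a2, b3) \<notin> E \<inter> X \<times> Y"
    "(a3, b1) \<notin> E \<inter> X \<times> Y" "(a4, b1) \<notin> E \<inter> X \<times> Y" "(a4, b2) \<notin> E \<inter> X \<times> Y"
    unfolding P7_free_def by blast
  then show False using P7_freeD[OF assms, of a1 b1 a2 b2 a3 b3 a4] by simp
qed

lemma P5K2_free_restrict: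
  assumes "P5K2_free E"
  shows "P5K2_free (E \<inter> X \<times> Y)"
proof (rule ccontr)
  assume "\<not> P5K2_free (E \<inter> X \<times> Y)"
  then obtain a1 a2 a3 a4 b1 b2 b3 where
    "(a1, b1) \<in> E \<inter> X \<times> Y" "(a2, b1) \<in> E \<inter> X \<times> Y" "(a2, b2) \<in> E \<inter> X \<times> Y" "(a3, b2) \<in> E \<inter> X \<times> Y"
    "(a4, b3) \<in> E \<inter> X \<times> Y"
    "(a1, b2) \<notin> E \<inter> X \<times> Y" "(a1, b3) \<notin> E \<inter> X \<times> Y" "(a2, b3) \<notin> E \<inter> X \<times> Y"
    "(a3, b1) \<notin> E \<inter> X \<times> Y" "(a3, b3) \<notin> E \<inter> X \<times> Y" "(a4, b1) \<notin> E \<inter> X \<times> Y" "(a4, b2) \<notin> E \<inter> X \<times> Y"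
    unfolding P5K2_free_def by blast
  then show False using P5K2_freeD[OF assms, of a1 b1 a2 b2 a3 a4 b3] by simp
qed

lemma free_relations_restrict:
  assumes "E \<in> free_relations A B"
  shows "E \<inter> X \<times> Y \<in> free_relations X Y"
proof -
  have "(E \<inter> X \<times> Y)\<inverse> = E\<inverse> \<inter> Y \<times> X" by auto
  then show ?thesis
    using assms P7_free_restrict[of E X Y] P5K2_free_restrict[of E X Y] P5K2_free_restrict[of "E\<inverse>" Y X]
    by (auto simp: free_relations_def)
qed

lemma finite_relations [simp]:
  assumes "finite A" "finite B"
  shows "finite (free_relations A B)" "finite (chain_relations A B)"
  by (rule finite_subset[of _ "Pow (A \<times> B)"]; use assms in \<open>auto simp: free_relations_def chain_relations_def\<close>)+

lemma sum_Pow_powers_le: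
  assumes "finite A" "card A < K"
  shows "(\<Sum>X\<in>Pow A. K ^ card (A - X)) \<le> K ^ Suc (card A)"
proof -
  have "(\<Sum>X\<in>Pow A. K ^ card (A - X)) = (\<Prod>x\<in>A. 1 + K)"
    using prod_add[OF assms(1), of "\<lambda>_. 1" "\<lambda>_. K"] by simp
  also have "\<dots> = Suc K ^ card A" by simp
  also have "m < K \<Longrightarrow> Suc K ^ m \<le> Suc m * K ^ m" for m
  proof (induction m)
    case (Suc m)
    have "Suc K ^ Suc m \<le> Suc K * (Suc m * K ^ m)"
      unfolding power_Suc[of "Suc K"] using Suc by (intro mult_left_mono) auto
    also have "\<dots> = (Suc K * Suc m) * K ^ m" by (simp only: mult.assoc)
    also have "\<dots> \<le> (Suc (Suc m) * K) * K ^ m" using Suc.prems by (intro mult_right_mono) auto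
    finally show ?case by (simp only: mult.assoc power_Suc)
  qed simp
  then have "Suc K ^ card A \<le> Suc (card A) * K ^ card A" using assms(2) .
  also have "\<dots> \<le> K * K ^ card A" using assms(2) by (intro mult_right_mono) auto
  finally show ?thesis by simp
qed

text \<open>
  The relations for which \<open>X\<close> and \<open>Y\<close> are as in \<open>matching3_module\<close>.
\<close>

definition module_relations :: "'a set \<Rightarrow> 'b set \<Rightarrow> 'a set \<Rightarrow> 'b set \<Rightarrow> ('a \<times> 'b) set set" where
  "module_relations A B X Y = {E \<in> free_relations A B.
     3 \<le> card X \<and> 3 \<le> card Y \<and>
     (\<forall>x\<in>X. \<forall>x'\<in>X. \<forall>w\<in>B - Y. (x, w) \<in> E \<longleftrightarrow> (x', w) \<in> E) \<and>
     (\<forall>y\<in>Y. \<forall>y'\<in>Y. \<forall>v\<in>A - X. (v, y) \<in> E \<longleftrightarrow> (v, y') \<in> E) \<and>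
     (\<exists>F0\<in>chain_relations X Y. \<exists>F1\<in>chain_relations X Y. \<exists>F2\<in>chain_relations X Y.
        E \<inter> X \<times> Y = F0 \<union> F1 \<union> F2)}"

text \<open>
  As the vertices outside see \<open>X\<close> and \<open>Y\<close> homogeneously, the relation left when \<open>X\<close> and \<open>Y\<close>
  are replaced by one representative each, \<open>a\<close> and \<open>b\<close>, is enough to recover all pairs that are
  not in \<open>X \<times> Y\<close>.
\<close>

lemma card_module_relations_le:
  assumes fin: "finite A" "finite B" and XY: "X \<subseteq> A" "Y \<subseteq> B" "a \<in> X" "b \<in> Y"
  shows "card (module_relations A B X Y) \<le>
    card (chain_relations X Y) ^ 3 * card (free_relations (insert a (A - X)) (insert b (B - Y)))"
proof -
  let ?L = "chain_relations X Y"
  let ?A = "insert a (A - X)" and ?B = "insert b (B - Y)"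
  let ?C = "?L \<times> ?L \<times> ?L \<times> free_relations ?A ?B"
  let ?R = "\<lambda>(F0, F1, F2, E') E. E \<inter> X \<times> Y = F0 \<union> F1 \<union> F2 \<and> E \<inter> ?A \<times> ?B = E'"
  have finXY: "finite X" "finite Y" using XY fin finite_subset by blast+
  have "card (module_relations A B X Y) \<le> card ?C"
  proof (rule card_le_card_codes[where R = ?R])
    show "finite ?C" using fin finXY by simp
  next
    fix E assume "E \<in> module_relations A B X Y"
    then obtain F0 F1 F2 where "E \<in> free_relations A B" "F0 \<in> ?L" "F1 \<in> ?L" "F2 \<in> ?L" "E \<inter> X \<times> Y = F0 \<union> F1 \<union> F2"
      unfolding module_relations_def mem_Collect_eq by (elim conjE bexE) (rule that; assumption)
    then show "\<exists>c\<in>?C. ?R c E"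
      using free_relations_restrict[of E A B ?A ?B]
      by (intro bexI[of _ "(F0, F1, F2, E \<inter> ?A \<times> ?B)"]) simp_all
  next
    fix c E E' assume mem: "E \<in> module_relations A B X Y" "E' \<in> module_relations A B X Y" and R: "?R c E" "?R c E'"
    have eq1: "E \<inter> X \<times> Y = E' \<inter> X \<times> Y" and eq2: "E \<inter> ?A \<times> ?B = E' \<inter> ?A \<times> ?B"
      using R by (auto split: prod.splits)
    have sub: "E \<subseteq> A \<times> B" "E' \<subseteq> A \<times> B"
      using mem by (auto simp: module_relations_def free_relations_def)
    have rows: "\<forall>x\<in>X. \<forall>x'\<in>X. \<forall>w\<in>B - Y. (x, w) \<in> D \<longleftrightarrow> (x', w) \<in> D"
      and cols: "\<forall>y\<in>Y. \<forall>y'\<in>Y. \<forall>v\<in>A - X. (v, y) \<in> D \<longleftrightarrow> (v, y') \<in> D"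
      if "D \<in> module_relations A B X Y" for D
      using that unfolding module_relations_def mem_Collect_eq by - (elim conjE, assumption)+
    have row: "(x, w) \<in> E \<longleftrightarrow> (a, w) \<in> E" "(x, w) \<in> E' \<longleftrightarrow> (a, w) \<in> E'" if "x \<in> X" "w \<in> B - Y" for x w
      using rows[OF mem(1)] rows[OF mem(2)] XY(3) that by meson+
    have col: "(v, y) \<in> E \<longleftrightarrow> (v, b) \<in> E" "(v, y) \<in> E' \<longleftrightarrow> (v, b) \<in> E'" if "y \<in> Y" "v \<in> A - X" for v y
      using cols[OF mem(1)] cols[OF mem(2)] XY(4) that by meson+
    have inner: "(x, y) \<in> E \<longleftrightarrow> (x, y) \<in> E'" if "x \<in> X" "y \<in> Y" for x y
      using eq1 that by blast
    have outer: "(x, y) \<in> E \<longleftrightarrow> (x, y) \<in> E'" if "x \<in> ?A" "y \<in> ?B" for x y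
      using eq2 that by blast
    have "(x, y) \<in> E \<longleftrightarrow> (x, y) \<in> E'" if "x \<in> A" "y \<in> B" for x y
    proof (cases "x \<in> X"; cases "y \<in> Y")
      assume "x \<in> X" "y \<notin> Y"
      then show ?thesis using row[of x y] outer[of a y] that by simp
    next
      assume "x \<notin> X" "y \<in> Y"
      then show ?thesis using col[of y x] outer[of x b] that by simp
    qed (use inner[of x y] outer[of x y] that in simp_all)
    then show "E = E'" using sub by blast
  qed
  also have "card ?C = card ?L ^ 3 * card (free_relations ?A ?B)"
    by (simp add: card_cartesian_product power3_eq_cube mult.assoc)
  finally show ?thesis .
qed

lemma free_relations_cases:
  assumes fin: "finite A" "finite B"
  shows "free_relations A B \<subseteq>
    (\<lambda>E. A \<times> B - E) ` chain_relations A B \<union> (\<Union>X\<in>Pow A. \<Union>Y\<in>Pow B. module_relations A B X Y)"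
proof
  fix E assume E: "E \<in> free_relations A B"
  then have sub: "E \<subseteq> A \<times> B" and free: "P7_free E" "P5K2_free E" "P5K2_free (E\<inverse>)"
    by (auto simp: free_relations_def)
  show "E \<in> (\<lambda>E. A \<times> B - E) ` chain_relations A B \<union> (\<Union>X\<in>Pow A. \<Union>Y\<in>Pow B. module_relations A B X Y)"
  proof (cases "\<exists>a b. matching3 E a b")
    case False
    then have "A \<times> B - E \<in> chain_relations A B" using complement_chain_relation[OF free(1)] by blast
    moreover have "E = A \<times> B - (A \<times> B - E)" using sub by blast
    ultimately show ?thesis by blast
  next
    case True
    then obtain a0 b0 where m: "matching3 E a0 b0" by blast
    show ?thesis
    proof (rule matching3_module[OF fin sub free(2,3) m])
      fix X Y F0 F1 F2 assume *: "X \<subseteq> A" "Y \<subseteq> B" "3 \<le> card X" "3 \<le> card Y"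
        "\<And>x x' w. x \<in> X \<Longrightarrow> x' \<in> X \<Longrightarrow> w \<in> B - Y \<Longrightarrow> (x, w) \<in> E \<longleftrightarrow> (x', w) \<in> E"
        "\<And>y y' v. y \<in> Y \<Longrightarrow> y' \<in> Y \<Longrightarrow> v \<in> A - X \<Longrightarrow> (v, y) \<in> E \<longleftrightarrow> (v, y') \<in> E"
        "E \<inter> X \<times> Y = F0 \<union> F1 \<union> F2"
        "F0 \<in> chain_relations X Y" "F1 \<in> chain_relations X Y" "F2 \<in> chain_relations X Y"
      have "E \<in> module_relations A B X Y"
        unfolding module_relations_def
      proof (intro CollectI conjI E *(3,4) ballI)
        show "\<exists>F0\<in>chain_relations X Y. \<exists>F1\<in>chain_relations X Y. \<exists>F2\<in>chain_relations X Y. E \<inter> X \<times> Y = F0 \<union> F1 \<union> F2"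
          using *(7-10) by blast
      qed (use *(5,6) in blast)+
      then show ?thesis using *(1,2) by blast
    qed
  qed
qed

text \<open>
  The exponent \<open>30\<close> used below is large enough here: contracting \<open>d \<ge> 6\<close> vertices to two
  saves \<open>30 (d - 2)\<close>. This pays \<open>15 d\<close> for the three families, \<open>d\<close> for the choice of the sets, and
  leaves at least \<open>24\<close>. With \<open>p = n - d\<close> the bound has the form in which it can be summed over the sets.
\<close>

lemma exponent_bound:
  fixes d n p q :: nat
  assumes "p + d = n" "6 \<le> d" "q + d = n + 2"
  shows "15 * d + 30 * q \<le> 29 * n - 24 + p"
proof -
  have "n = p + d" "q = p + 2" "24 \<le> 29 * d" using assms by auto
  then have "29 * n - 24 = 29 * p + (29 * d - 24)" by simp
  then show ?thesis using \<open>n = p + d\<close> \<open>q = p + 2\<close> assms(2) by simp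
qed

text \<open>
  Induction on the number of vertices, using \<open>free_relations_cases\<close>. Relations without an
  induced matching of three edges contribute at most \<open>K\<^bsup>5n\<^esup>\<close>; the others are summed over
  all pairs \<open>(X, Y)\<close>.
\<close>

lemma card_free_relations_le:
  assumes "finite A" "finite B" "card A + card B < K"
  shows "card (free_relations A B) \<le> K ^ (30 * (card A + card B))"
  using assms
proof (induction "card A + card B" arbitrary: A B rule: less_induct)
  case less
  note fin = less.prems(1,2)
  let ?n = "card A + card B"
  let ?M = "\<lambda>X Y. module_relations A B X Y"
  let ?U = "\<Union>X\<in>Pow A. \<Union>Y\<in>Pow B. ?M X Y"
  have M: "card (?M X Y) \<le> K ^ (29 * ?n - 24) * (K ^ card (A - X) * K ^ card (B - Y)) \<and> (?M X Y \<noteq> {} \<longrightarrow> 6 \<le> ?n)"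
    if XY: "X \<in> Pow A" "Y \<in> Pow B" for X Y
  proof (cases "3 \<le> card X \<and> 3 \<le> card Y")
    case False
    then have "?M X Y = {}" by (auto simp: module_relations_def)
    then show ?thesis by simp
  next
    case True
    then obtain a b where ab: "a \<in> X" "b \<in> Y" by (metis card.empty ex_in_conv not_numeral_le_zero)
    let ?d = "card X + card Y"
    have finXY: "finite X" "finite Y" using XY fin finite_subset by blast+
    have le: "card X \<le> card A" "card Y \<le> card B" using XY fin by (auto intro: card_mono)
    have diff: "card (A - X) = card A - card X" "card (B - Y) = card B - card Y"
      using XY finXY by (auto intro: card_Diff_subset)
    let ?A = "insert a (A - X)" and ?B = "insert b (B - Y)"
    have cards: "card ?A + card ?B + ?d = ?n + 2"
      using ab fin le diff by (simp add: card_insert_if)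
    then have "card (free_relations ?A ?B) \<le> K ^ (30 * (card ?A + card ?B))"
      using True fin less.prems(3) by (intro less.hyps) auto
    moreover have "card (chain_relations X Y) \<le> K ^ (5 * ?d)"
      using le less.prems(3) by (intro card_chain_relations_le finXY) simp
    then have "card (chain_relations X Y) ^ 3 \<le> (K ^ (5 * ?d)) ^ 3" by (rule power_mono) simp
    ultimately have "card (chain_relations X Y) ^ 3 * card (free_relations ?A ?B) \<le>
        (K ^ (5 * ?d)) ^ 3 * K ^ (30 * (card ?A + card ?B))"
      by (intro mult_mono) simp_all
    also have "\<dots> = K ^ (15 * ?d + 30 * (card ?A + card ?B))"
      by (simp add: mult.commute flip: power_mult power_add)
    also have "\<dots> \<le> K ^ ((29 * ?n - 24) + (card (A - X) + card (B - Y)))"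
    proof (rule power_increasing)
      have "card (A - X) + card (B - Y) + ?d = ?n" using le diff by simp
      moreover have "6 \<le> ?d" using True by simp
      ultimately show "15 * ?d + 30 * (card ?A + card ?B) \<le> 29 * ?n - 24 + (card (A - X) + card (B - Y))"
        using cards by (intro exponent_bound)
    qed (use less.prems(3) in simp)
    also have "\<dots> = K ^ (29 * ?n - 24) * (K ^ card (A - X) * K ^ card (B - Y))"
      by (simp only: power_add)
    finally show ?thesis
      using card_module_relations_le[OF fin _ _ ab] XY True le by auto
  qed
  have finM: "finite (?M X Y)" for X Y
    using finite_relations(1)[OF fin] by (rule finite_subset[rotated]) (auto simp: module_relations_def)
  have finU: "finite ?U" using fin finM by simp
  have U: "card ?U \<le> K ^ (30 * ?n - 1) \<and> (?U \<noteq> {} \<longrightarrow> 6 \<le> ?n)"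
  proof (cases "?U = {}")
    case True
    then show ?thesis by simp
  next
    case False
    then have n: "6 \<le> ?n" using M by blast
    have "card ?U \<le> (\<Sum>X\<in>Pow A. card (\<Union>Y\<in>Pow B. ?M X Y))"
      using fin by (intro card_UN_le) simp
    also have "\<dots> \<le> (\<Sum>X\<in>Pow A. \<Sum>Y\<in>Pow B. card (?M X Y))"
      using fin by (intro sum_mono card_UN_le) simp
    also have "\<dots> \<le> (\<Sum>X\<in>Pow A. \<Sum>Y\<in>Pow B. K ^ (29 * ?n - 24) * (K ^ card (A - X) * K ^ card (B - Y)))"
      using M by (intro sum_mono) blast
    also have "\<dots> = K ^ (29 * ?n - 24) * ((\<Sum>X\<in>Pow A. K ^ card (A - X)) * (\<Sum>Y\<in>Pow B. K ^ card (B - Y)))"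
      unfolding sum_product unfolding sum_distrib_left by (rule refl)
    also have "\<dots> \<le> K ^ (29 * ?n - 24) * (K ^ Suc (card A) * K ^ Suc (card B))"
      using less.prems by (intro mult_left_mono mult_mono sum_Pow_powers_le) auto
    also have "\<dots> = K ^ (29 * ?n - 24 + (Suc (card A) + Suc (card B)))"
      by (simp only: power_add)
    also have "\<dots> \<le> K ^ (30 * ?n - 1)"
    proof (rule power_increasing)
      obtain e where "?n = 6 + e" using n le_Suc_ex by blast
      moreover from this have "Suc (card A) + Suc (card B) = 8 + e" by simp
      ultimately show "29 * ?n - 24 + (Suc (card A) + Suc (card B)) \<le> 30 * ?n - 1"
        by simp
    qed (use less.prems(3) in simp)
    finally show ?thesis using n by blast
  qed
  have "card (free_relations A B) \<le> card ((\<lambda>E. A \<times> B - E) ` chain_relations A B \<union> ?U)"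
    using free_relations_cases[OF fin] finU fin by (intro card_mono) auto
  also have "\<dots> \<le> card ((\<lambda>E. A \<times> B - E) ` chain_relations A B) + card ?U" by (rule card_Un_le)
  also have "\<dots> \<le> K ^ (5 * ?n) + card ?U"
    using card_image_le[OF finite_relations(2)[OF fin]] card_chain_relations_le[OF less.prems] le_trans by fastforce
  also have "\<dots> \<le> K ^ (30 * ?n)"
  proof (cases "?U = {}")
    case True
    then show ?thesis using less.prems(3) by (simp add: power_increasing)
  next
    case False
    then have n: "6 \<le> ?n" using U by blast
    have "K ^ (5 * ?n) \<le> K ^ (30 * ?n - 1)"
    proof (rule power_increasing)
      obtain e where "?n = 6 + e" using n le_Suc_ex by blast
      then show "5 * ?n \<le> 30 * ?n - 1" by simp
    qed (use less.prems(3) in simp)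
    then have "K ^ (5 * ?n) + card ?U \<le> 2 * K ^ (30 * ?n - 1)" using U by linarith
    also have "\<dots> \<le> K * K ^ (30 * ?n - 1)" using n less.prems(3) by (intro mult_right_mono) auto
    also have "\<dots> = K ^ (30 * ?n)" using n by (cases "30 * ?n") auto
    finally show ?thesis .
  qed
  finally show ?case .
qed

section \<open>Induced subgraphs and biadjacency relations\<close>

text \<open>
  Being free of an induced subgraph is easier to transfer along maps that go from the pattern
  into the graph.
\<close>

definition embeds :: "'b graph \<Rightarrow> 'a graph \<Rightarrow> ('b \<Rightarrow> 'a) \<Rightarrow> bool" where
  "embeds P G g \<longleftrightarrow> inj_on g (verts P) \<and> g ` verts P \<subseteq> verts G \<and>
     (\<forall>u\<in>verts P. \<forall>v\<in>verts P. {u, v} \<in> edges P \<longleftrightarrow> {g u, g v} \<in> edges G)"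

lemma induced_free_iff: "induced_free P G \<longleftrightarrow> (\<nexists>g. embeds P G g)"
proof -
  have "\<exists>g. embeds P G g" if U: "U \<subseteq> verts G" and iso: "graph_iso (induced_subgraph G U) P" for U
  proof -
    obtain f where f: "bij_betw f U (verts P)"
      and e: "\<And>u v. u \<in> U \<Longrightarrow> v \<in> U \<Longrightarrow> {u, v} \<in> edges G \<longleftrightarrow> {f u, f v} \<in> edges P"
      using iso unfolding graph_iso_def induced_subgraph_def by auto
    let ?g = "inv_into U f"
    have bij: "bij_betw ?g (verts P) U" using f by (rule bij_betw_inv_into)
    have mem: "?g u \<in> U" if "u \<in> verts P" for u using bij that by (rule bij_betwE[rule_format])
    have inv: "f (?g u) = u" if "u \<in> verts P" for u using f that by (rule bij_betw_inv_into_right)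
    have "embeds P G ?g"
      unfolding embeds_def
    proof (intro conjI ballI)
      show "inj_on ?g (verts P)" using bij by (rule bij_betw_imp_inj_on)
      show "?g ` verts P \<subseteq> verts G" using mem U by blast
      fix u v assume "u \<in> verts P" "v \<in> verts P"
      then show "{u, v} \<in> edges P \<longleftrightarrow> {?g u, ?g v} \<in> edges G" using e[OF mem mem] inv by simp
    qed
    then show ?thesis by blast
  qed
  moreover have "\<exists>U\<subseteq>verts G. graph_iso (induced_subgraph G U) P" if g: "embeds P G g" for g
  proof (intro exI conjI)
    let ?f = "inv_into (verts P) g"
    have inj: "inj_on g (verts P)" using g by (simp add: embeds_def)
    then have "bij_betw ?f (g ` verts P) (verts P)" by (intro bij_betw_inv_into inj_on_imp_bij_betw)
    then show "graph_iso (induced_subgraph G (g ` verts P)) P"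
      unfolding graph_iso_def induced_subgraph_def
      using g inj by (intro exI[of _ ?f]) (auto simp: embeds_def)
    show "g ` verts P \<subseteq> verts G" using g by (simp add: embeds_def)
  qed
  ultimately show ?thesis unfolding induced_free_def by blast
qed

lemma embeds_comp:
  assumes "embeds P G g" "inj_on h (verts G)" "h ` verts G \<subseteq> verts H"
    "\<And>u v. u \<in> verts G \<Longrightarrow> v \<in> verts G \<Longrightarrow> {u, v} \<in> edges G \<longleftrightarrow> {h u, h v} \<in> edges H"
  shows "embeds P H (h \<circ> g)"
proof -
  have g: "g u \<in> verts G" if "u \<in> verts P" for u using assms(1) that by (auto simp: embeds_def)
  have "inj_on (h \<circ> g) (verts P)"
    using assms(1,2) by (auto simp: embeds_def intro: comp_inj_on inj_on_subset)
  moreover have "{u, v} \<in> edges P \<longleftrightarrow> {h (g u), h (g v)} \<in> edges H" if "u \<in> verts P" "v \<in> verts P" for u v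
    using assms(1,4) g that by (auto simp: embeds_def)
  ultimately show ?thesis using assms(3) g by (auto simp: embeds_def)
qed

lemma induced_free_embedded:
  assumes "induced_free P H" "inj_on h (verts G)" "h ` verts G \<subseteq> verts H"
    "\<And>u v. u \<in> verts G \<Longrightarrow> v \<in> verts G \<Longrightarrow> {u, v} \<in> edges G \<longleftrightarrow> {h u, h v} \<in> edges H"
  shows "induced_free P G"
  using assms embeds_comp[OF _ assms(2-4)] unfolding induced_free_iff by blast

definition bipartition :: "'a set \<Rightarrow> 'a set \<Rightarrow> 'a graph \<Rightarrow> bool" where
  "bipartition A B G \<longleftrightarrow> A \<union> B = verts G \<and> A \<inter> B = {} \<and> (\<forall>e\<in>edges G. \<exists>a\<in>A. \<exists>b\<in>B. e = {a, b})"

lemma bipartite_iff: "bipartite G \<longleftrightarrow> (\<exists>A B. bipartition A B G)"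
  by (simp add: bipartite_def bipartition_def)

lemma bipartition_commute: "bipartition A B G \<longleftrightarrow> bipartition B A G"
proof -
  have "bipartition B A G" if "bipartition A B G" for A B
    using that unfolding bipartition_def by (metis insert_commute Un_commute Int_commute)
  then show ?thesis by blast
qed

definition biadjacency :: "'a set \<Rightarrow> 'a set \<Rightarrow> 'a graph \<Rightarrow> ('a \<times> 'a) set" where
  "biadjacency A B G = {(a, b). a \<in> A \<and> b \<in> B \<and> {a, b} \<in> edges G}"

lemma biadjacency_converse: "(biadjacency A B G)\<inverse> = biadjacency B A G"
  by (auto simp: biadjacency_def insert_commute)

lemma bipartition_same_side:
  assumes "bipartition A B G" "{x, y} \<in> edges G" shows "\<not> (x \<in> A \<and> y \<in> A)" "\<not> (x \<in> B \<and> y \<in> B)"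
proof -
  obtain a b where "a \<in> A" "b \<in> B" "{x, y} = {a, b}" and "A \<inter> B = {}"
    using assms unfolding bipartition_def by meson
  then show "\<not> (x \<in> A \<and> y \<in> A)" "\<not> (x \<in> B \<and> y \<in> B)"
    unfolding doubleton_eq_iff by blast+
qed

lemma bipartition_edges:
  assumes "bipartition A B G"
  shows "edges G = (\<lambda>(a, b). {a, b}) ` biadjacency A B G"
proof
  show "edges G \<subseteq> (\<lambda>(a, b). {a, b}) ` biadjacency A B G"
  proof
    fix e assume e: "e \<in> edges G"
    then obtain a b where ab: "a \<in> A" "b \<in> B" "e = {a, b}" using assms unfolding bipartition_def by meson
    then have "(a, b) \<in> biadjacency A B G" using e by (simp add: biadjacency_def)
    then show "e \<in> (\<lambda>(a, b). {a, b}) ` biadjacency A B G" using ab by force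
  qed
qed (auto simp: biadjacency_def)

text \<open>
  For a pattern given with a bipartition of its own, only pairs with one vertex on each side have to be
  compared.
\<close>

lemma embeds_bipartition:
  assumes bip: "bipartition A B G" and P: "verts P = PA \<union> PB"
    and side: "g ` PA \<subseteq> A" "g ` PB \<subseteq> B" and inj: "inj_on g PA" "inj_on g PB"
    and indep: "\<And>u v. u \<in> PA \<Longrightarrow> v \<in> PA \<Longrightarrow> {u, v} \<notin> edges P" "\<And>u v. u \<in> PB \<Longrightarrow> v \<in> PB \<Longrightarrow> {u, v} \<notin> edges P"
    and cross: "\<And>u v. u \<in> PA \<Longrightarrow> v \<in> PB \<Longrightarrow> {u, v} \<in> edges P \<longleftrightarrow> (g u, g v) \<in> biadjacency A B G"
  shows "embeds P G g"
  unfolding embeds_def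
proof (intro conjI ballI)
  have disj: "A \<inter> B = {}" "A \<union> B = verts G" using bip by (auto simp: bipartition_def)
  show "g ` verts P \<subseteq> verts G" using P side disj by auto
  have "g u \<noteq> g v" if "u \<in> PA" "v \<in> PB" for u v using that side disj by blast
  then show "inj_on g (verts P)" using inj unfolding P inj_on_def by (metis Un_iff)
  have cross': "{u, v} \<in> edges P \<longleftrightarrow> {g u, g v} \<in> edges G" if "u \<in> PA" "v \<in> PB" for u v
  proof -
    have "g u \<in> A" "g v \<in> B" using that side by auto
    then show ?thesis using cross[OF that] by (simp add: biadjacency_def)
  qed
  fix u v assume uv: "u \<in> verts P" "v \<in> verts P"
  consider "u \<in> PA" "v \<in> PA" | "u \<in> PB" "v \<in> PB" | "u \<in> PA" "v \<in> PB" | "u \<in> PB" "v \<in> PA"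
    using uv P by blast
  then show "{u, v} \<in> edges P \<longleftrightarrow> {g u, g v} \<in> edges G"
  proof cases
    case 1
    then show ?thesis using indep(1)[OF 1] bipartition_same_side(1)[OF bip, of "g u" "g v"] side by auto
  next
    case 2
    then show ?thesis using indep(2)[OF 2] bipartition_same_side(2)[OF bip, of "g u" "g v"] side by auto
  next
    case 3
    then show ?thesis by (rule cross')
  next
    case 4
    then show ?thesis using cross'[of v u] by (simp add: insert_commute)
  qed
qed

lemma path_graph_edge_iff: "{u, v} \<in> edges (path_graph m) \<longleftrightarrow> v = Suc u \<and> v < m \<or> u = Suc v \<and> u < m"
  by (auto simp: path_graph_def doubleton_eq_iff)

lemma complete_graph_edge_iff: "{u, v} \<in> edges (complete_graph m) \<longleftrightarrow> u \<noteq> v \<and> u < m \<and> v < m"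
  by (auto simp: complete_graph_def card_insert_if)

lemma disjoint_union_edge_iff:
  "{Inl u, Inl v} \<in> edges (disjoint_union G H) \<longleftrightarrow> {u, v} \<in> edges G"
  "{Inr x, Inr y} \<in> edges (disjoint_union G H) \<longleftrightarrow> {x, y} \<in> edges H"
  "{Inl u, Inr x} \<in> edges (disjoint_union G H) \<longleftrightarrow> False"
  "{Inr x, Inl u} \<in> edges (disjoint_union G H) \<longleftrightarrow> False"
proof -
  have l: "{Inl u, Inl v} = Inl ` {u, v}" and r: "{Inr x, Inr y} = Inr ` {x, y}" by auto
  have "Inl ` e \<in> (`) Inl ` S \<longleftrightarrow> e \<in> S" "Inr ` d \<in> (`) Inr ` T \<longleftrightarrow> d \<in> T" for e d S T
    by (auto simp: inj_image_eq_iff)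
  moreover have "Inl ` {u, v} \<notin> (`) Inr ` T" "Inr ` {x, y} \<notin> (`) Inl ` S" for S T by blast+
  ultimately show "{Inl u, Inl v} \<in> edges (disjoint_union G H) \<longleftrightarrow> {u, v} \<in> edges G"
    "{Inr x, Inr y} \<in> edges (disjoint_union G H) \<longleftrightarrow> {x, y} \<in> edges H"
    unfolding disjoint_union_def l r snd_conv Un_iff by metis+
  show "{Inl u, Inr x} \<in> edges (disjoint_union G H) \<longleftrightarrow> False" "{Inr x, Inl u} \<in> edges (disjoint_union G H) \<longleftrightarrow> False"
    unfolding disjoint_union_def by (auto simp: set_eq_iff image_iff)
qed

abbreviation P5_plus_K2 :: "(nat + nat) graph" where
  "P5_plus_K2 \<equiv> disjoint_union (path_graph 5) (complete_graph 2)"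

lemma P7_free_biadjacency:
  assumes bip: "bipartition A B G" and free: "induced_free (path_graph 7) G"
  shows "P7_free (biadjacency A B G)"
proof (rule ccontr)
  let ?E = "biadjacency A B G"
  assume "\<not> P7_free ?E"
  then obtain a1 a2 a3 a4 b1 b2 b3 where
    E: "(a1, b1) \<in> ?E" "(a2, b1) \<in> ?E" "(a2, b2) \<in> ?E" "(a3, b2) \<in> ?E" "(a3, b3) \<in> ?E" "(a4, b3) \<in> ?E"
     "(a1, b2) \<notin> ?E" "(a1, b3) \<notin> ?E" "(a2, b3) \<notin> ?E" "(a3, b1) \<notin> ?E" "(a4, b1) \<notin> ?E" "(a4, b2) \<notin> ?E"
    unfolding P7_free_def by blast
  have mem: "a1 \<in> A" "a2 \<in> A" "a3 \<in> A" "a4 \<in> A" "b1 \<in> B" "b2 \<in> B" "b3 \<in> B"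
    using E(1-6) by (auto simp: biadjacency_def)
  have dist: "distinct [a1, a2, a3, a4]" "distinct [b1, b2, b3]" using E by auto
  have "embeds (path_graph 7) G ((!) [a1, b1, a2, b2, a3, b3, a4])"
  proof (rule embeds_bipartition[OF bip, of _ "{0, 2, 4, 6}" "{1, 3, 5}"])
    show "verts (path_graph 7) = {0, 2, 4, 6} \<union> {1, 3, 5}" by (auto simp: path_graph_def)
  qed (use E mem dist in \<open>auto simp: path_graph_edge_iff\<close>)
  then show False using free by (auto simp: induced_free_iff)
qed

lemma P5K2_free_biadjacency:
  assumes bip: "bipartition A B G" and free: "induced_free P5_plus_K2 G"
  shows "P5K2_free (biadjacency A B G)"
proof (rule ccontr)
  let ?E = "biadjacency A B G"
  assume "\<not> P5K2_free ?E"
  then obtain a1 a2 a3 a4 b1 b2 b3 where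
    E: "(a1, b1) \<in> ?E" "(a2, b1) \<in> ?E" "(a2, b2) \<in> ?E" "(a3, b2) \<in> ?E" "(a4, b3) \<in> ?E"
     "(a1, b2) \<notin> ?E" "(a1, b3) \<notin> ?E" "(a2, b3) \<notin> ?E" "(a3, b1) \<notin> ?E" "(a3, b3) \<notin> ?E" "(a4, b1) \<notin> ?E" "(a4, b2) \<notin> ?E"
    unfolding P5K2_free_def by blast
  have mem: "a1 \<in> A" "a2 \<in> A" "a3 \<in> A" "a4 \<in> A" "b1 \<in> B" "b2 \<in> B" "b3 \<in> B"
    using E(1-5) by (auto simp: biadjacency_def)
  have dist: "distinct [a1, a2, a3, a4]" "distinct [b1, b2, b3]" using E by auto
  have "embeds P5_plus_K2 G (case_sum ((!) [a1, b1, a2, b2, a3]) ((!) [a4, b3]))"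
  proof (rule embeds_bipartition[OF bip, of _ "{Inl 0, Inl 2, Inl 4, Inr 0}" "{Inl 1, Inl 3, Inr 1}"])
    show "verts P5_plus_K2 = {Inl 0, Inl 2, Inl 4, Inr 0} \<union> {Inl 1, Inl 3, Inr 1}"
      by (auto simp: path_graph_def complete_graph_def disjoint_union_def)
  qed (use E mem dist in \<open>auto simp: disjoint_union_edge_iff path_graph_edge_iff complete_graph_edge_iff
      disjoint_union_edge_iff(1)[of u u for u, simplified] disjoint_union_edge_iff(2)[of u u for u, simplified]
      path_graph_edge_iff[of u u for u, simplified] complete_graph_edge_iff[of u u for u, simplified]\<close>)
  then show False using free by (auto simp: induced_free_iff)
qed

definition P7_P5K2_free_bipartite :: "nat graph set" where
  "P7_P5K2_free_bipartite = {G. simple_graph G \<and> bipartite G \<and> induced_free (path_graph 7) G \<and> induced_free P5_plus_K2 G}"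

lemma biadjacency_free:
  assumes "G \<in> P7_P5K2_free_bipartite" "bipartition A B G"
  shows "biadjacency A B G \<in> free_relations A B"
proof -
  have "bipartition B A G" using assms(2) by (simp add: bipartition_commute)
  then show ?thesis
    using assms P7_free_biadjacency[of A B G] P5K2_free_biadjacency[of A B G] P5K2_free_biadjacency[of B A G]
    by (auto simp: free_relations_def P7_P5K2_free_bipartite_def biadjacency_converse) (auto simp: biadjacency_def)
qed

lemma labelled_count_le: "labelled_count P7_P5K2_free_bipartite n \<le> 2 ^ n * Suc n ^ (30 * n)"
proof -
  let ?V = "{1..n}"
  let ?C = "SIGMA A:Pow ?V. free_relations A (?V - A)"
  let ?R = "\<lambda>(A, E) G. bipartition A (?V - A) G \<and> biadjacency A (?V - A) G = E"
  have fin: "finite A" "finite (?V - A)" if "A \<in> Pow ?V" for A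
    using that finite_subset[of A ?V] by auto
  have "labelled_count P7_P5K2_free_bipartite n \<le> card ?C"
    unfolding labelled_count_def
  proof (rule card_le_card_codes[where R = ?R])
    show "finite ?C" using fin by (intro finite_SigmaI) auto
  next
    fix G assume G: "G \<in> {G \<in> P7_P5K2_free_bipartite. verts G = ?V}"
    then obtain A B where AB: "bipartition A B G" by (auto simp: P7_P5K2_free_bipartite_def bipartite_iff)
    then have "B = ?V - A" "A \<subseteq> ?V" using G by (auto simp: bipartition_def)
    then show "\<exists>c\<in>?C. ?R c G"
      using AB G biadjacency_free[OF _ AB] by (intro bexI[of _ "(A, biadjacency A B G)"]) auto
  next
    fix c G H assume GH: "G \<in> {G \<in> P7_P5K2_free_bipartite. verts G = ?V}" "H \<in> {G \<in> P7_P5K2_free_bipartite. verts G = ?V}"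
      and R: "?R c G" "?R c H"
    obtain A E where c: "c = (A, E)" by (cases c)
    have "edges G = edges H"
      using R bipartition_edges[of A "?V - A" G] bipartition_edges[of A "?V - A" H] unfolding c by simp
    then show "G = H" using GH by (auto simp: prod_eq_iff)
  qed
  also have "card ?C = (\<Sum>A\<in>Pow ?V. card (free_relations A (?V - A)))"
    using fin by (intro card_SigmaI) auto
  also have "\<dots> \<le> (\<Sum>A\<in>Pow ?V. Suc n ^ (30 * n))"
  proof (rule sum_mono)
    fix A assume A: "A \<in> Pow ?V"
    have "card A + card (?V - A) = n"
      using A fin[OF A] card_mono[of ?V A] by (simp add: card_Diff_subset)
    then show "card (free_relations A (?V - A)) \<le> Suc n ^ (30 * n)"
      using card_free_relations_le[OF fin[OF A], of "Suc n"] by simp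
  qed
  also have "\<dots> = 2 ^ n * Suc n ^ (30 * n)" by (simp add: card_Pow)
  finally show ?thesis .
qed

section \<open>Star forests\<close>

definition star_forest :: "nat \<Rightarrow> nat \<Rightarrow> (nat \<Rightarrow> nat) \<Rightarrow> nat graph" where
  "star_forest n m f = ({1..n}, {{i, f i} | i. i \<in> {1..m}})"

text \<open>
  Each vertex up to \<open>m\<close> is a leaf: its only neighbour is its image under \<open>f\<close>, which is larger than \<open>m\<close>.
\<close>

lemma star_forest_edge:
  assumes "f \<in> {1..m} \<rightarrow>\<^sub>E {m<..n}" "{x, y} \<in> edges (star_forest n m f)"
  shows "x \<in> {1..m} \<and> y = f x \<or> y \<in> {1..m} \<and> x = f y" "x \<in> {1..m} \<Longrightarrow> y = f x"
proof -
  show *: "x \<in> {1..m} \<and> y = f x \<or> y \<in> {1..m} \<and> x = f y"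
    using assms(2) by (auto simp: star_forest_def doubleton_eq_iff)
  show "y = f x" if "x \<in> {1..m}"
    using * that PiE_mem[OF assms(1), of y] by auto
qed

text \<open>
  Of the two inner vertices of a \<open>P\<^sub>4\<close> one is a leaf of a star, yet both have two neighbours.
\<close>

lemma star_forest_no_P4:
  assumes f: "f \<in> {1..m} \<rightarrow>\<^sub>E {m<..n}" and e: "embeds P (star_forest n m f) g"
    and u: "u0 \<in> verts P" "u1 \<in> verts P" "u2 \<in> verts P" "u3 \<in> verts P" "u0 \<noteq> u2" "u1 \<noteq> u3"
    and path: "{u0, u1} \<in> edges P" "{u1, u2} \<in> edges P" "{u2, u3} \<in> edges P"
  shows False
proof -
  have inj: "g u0 \<noteq> g u2" "g u1 \<noteq> g u3" using e u by (auto simp: embeds_def inj_on_eq_iff)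
  have edges: "{g u1, g u0} \<in> edges (star_forest n m f)" "{g u1, g u2} \<in> edges (star_forest n m f)"
    "{g u2, g u1} \<in> edges (star_forest n m f)" "{g u2, g u3} \<in> edges (star_forest n m f)"
    using e u path by (auto simp: embeds_def insert_commute)
  have "g u1 \<in> {1..m} \<or> g u2 \<in> {1..m}" using star_forest_edge(1)[OF f edges(2)] by blast
  moreover have "g u0 = g u2" if "g u1 \<in> {1..m}"
    using star_forest_edge(2)[OF f edges(1) that] star_forest_edge(2)[OF f edges(2) that] by simp
  moreover have "g u1 = g u3" if "g u2 \<in> {1..m}"
    using star_forest_edge(2)[OF f edges(3) that] star_forest_edge(2)[OF f edges(4) that] by simp
  ultimately show False using inj by blast
qed

lemma star_forest_in_class:
  assumes f: "f \<in> {1..m} \<rightarrow>\<^sub>E {m<..n}" and m: "m \<le> n"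
  shows "star_forest n m f \<in> P7_P5K2_free_bipartite"
proof -
  have fi: "f i \<in> {m<..n}" if "i \<in> {1..m}" for i using PiE_mem[OF f that] .
  have ne: "i \<noteq> f i" "f i \<le> n" "1 \<le> f i" if "i \<in> {1..m}" for i using fi[OF that] that by auto
  have "simple_graph (star_forest n m f)"
    using ne m unfolding simple_graph_def star_forest_def by (auto simp: card_insert_if)
  moreover have "bipartition {1..m} {m<..n} (star_forest n m f)"
    using fi m unfolding bipartition_def star_forest_def by fastforce
  moreover have "induced_free (path_graph 7) (star_forest n m f)"
    unfolding induced_free_iff
    using star_forest_no_P4[OF f, of "path_graph 7" _ 0 1 2 3] by (auto simp: path_graph_edge_iff) (auto simp: path_graph_def)
  moreover have "Inl i \<in> verts P5_plus_K2" if "i < 5" for i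
    using that by (simp add: disjoint_union_def path_graph_def InlI)
  then have "induced_free P5_plus_K2 (star_forest n m f)"
    unfolding induced_free_iff
    using star_forest_no_P4[OF f, of P5_plus_K2 _ "Inl 0" "Inl 1" "Inl 2" "Inl 3"]
    by (auto simp: path_graph_edge_iff disjoint_union_edge_iff)
  ultimately show ?thesis unfolding P7_P5K2_free_bipartite_def bipartite_iff by blast
qed

lemma labelled_count_ge:
  assumes m: "m \<le> n"
  shows "(n - m) ^ m \<le> labelled_count P7_P5K2_free_bipartite n"
proof -
  let ?F = "{1..m} \<rightarrow>\<^sub>E {m<..n}"
  have inj: "inj_on (star_forest n m) ?F"
  proof (rule inj_onI)
    fix f g assume fg: "f \<in> ?F" "g \<in> ?F" "star_forest n m f = star_forest n m g"
    show "f = g"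
    proof (rule PiE_ext[OF fg(1,2)])
      fix i assume i: "i \<in> {1..m}"
      then have "{i, f i} \<in> edges (star_forest n m g)"
        unfolding fg(3)[symmetric] by (auto simp: star_forest_def)
      then show "f i = g i" using star_forest_edge(2)[OF fg(2)] i by blast
    qed
  qed
  have "{G \<in> P7_P5K2_free_bipartite. verts G = {1..n}} \<subseteq> {{1..n}} \<times> Pow (Pow {1..n})"
  proof
    fix G assume G: "G \<in> {G \<in> P7_P5K2_free_bipartite. verts G = {1..n}}"
    then have "simple_graph G" and V: "verts G = {1..n}"
      by (simp_all add: P7_P5K2_free_bipartite_def)
    then have "\<forall>e\<in>edges G. e \<subseteq> {1..n}" unfolding simple_graph_def V by blast
    then have "edges G \<in> Pow (Pow {1..n})" by blast
    then show "G \<in> {{1..n}} \<times> Pow (Pow {1..n})" using G by (simp add: mem_Times_iff)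
  qed
  then have fin: "finite {G \<in> P7_P5K2_free_bipartite. verts G = {1..n}}"
    by (rule finite_subset) simp
  have "(n - m) ^ m = card ?F" by (simp add: card_PiE)
  also have "\<dots> = card (star_forest n m ` ?F)" using inj by (simp add: card_image)
  also have "\<dots> \<le> labelled_count P7_P5K2_free_bipartite n"
    unfolding labelled_count_def using star_forest_in_class m fin
    by (intro card_mono) (auto simp: star_forest_def)
  finally show ?thesis .
qed

section \<open>The class is hereditary\<close>

lemma hereditary_P7_P5K2_free_bipartite: "hereditary_class P7_P5K2_free_bipartite"
  unfolding hereditary_class_def
proof (intro conjI ballI allI impI)
  fix G assume "G \<in> P7_P5K2_free_bipartite"
  then show "simple_graph G" by (simp add: P7_P5K2_free_bipartite_def)
next
  fix G H :: "nat graph" assume G: "G \<in> P7_P5K2_free_bipartite" and H: "simple_graph H \<and> graph_iso G H"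
  obtain f where f: "bij_betw f (verts G) (verts H)"
    and e: "\<And>u v. u \<in> verts G \<Longrightarrow> v \<in> verts G \<Longrightarrow> {u, v} \<in> edges G \<longleftrightarrow> {f u, f v} \<in> edges H"
    using H by (auto simp: graph_iso_def)
  let ?g = "inv_into (verts G) f"
  have bij: "bij_betw ?g (verts H) (verts G)" using f by (rule bij_betw_inv_into)
  have mem: "?g u \<in> verts G" if "u \<in> verts H" for u using bij that by (rule bij_betwE[rule_format])
  have inv: "f (?g u) = u" if "u \<in> verts H" for u using f that by (rule bij_betw_inv_into_right)
  have e': "{u, v} \<in> edges H \<longleftrightarrow> {?g u, ?g v} \<in> edges G" if "u \<in> verts H" "v \<in> verts H" for u v
    using e[OF mem[OF that(1)] mem[OF that(2)]] inv that by simp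
  have inj: "inj_on ?g (verts H)" and sub: "?g ` verts H \<subseteq> verts G"
    using bij by (auto simp: bij_betw_def)
  have free: "induced_free (path_graph 7) H" "induced_free P5_plus_K2 H"
    using G by (auto simp: P7_P5K2_free_bipartite_def intro: induced_free_embedded[OF _ inj sub e'])
  obtain A B where AB: "bipartition A B G" using G by (auto simp: P7_P5K2_free_bipartite_def bipartite_iff)
  have "bipartition (f ` A) (f ` B) H"
    unfolding bipartition_def
  proof (intro conjI ballI)
    have V: "A \<union> B = verts G" "A \<inter> B = {}" using AB by (auto simp: bipartition_def)
    show "f ` A \<union> f ` B = verts H" using V f by (metis bij_betw_imp_surj_on image_Un)
    show "f ` A \<inter> f ` B = {}" using V f by (metis bij_betw_def inj_on_image_Int image_empty Un_upper1 Un_upper2)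
    fix d assume d: "d \<in> edges H"
    then obtain x y where xy: "d = {x, y}" "x \<in> verts H" "y \<in> verts H"
      using H unfolding simple_graph_def by (metis card_2_iff insert_subset)
    then have "{?g x, ?g y} \<in> edges G" using d e' by simp
    then obtain a b where ab: "a \<in> A" "b \<in> B" "{?g x, ?g y} = {a, b}" using AB by (auto simp: bipartition_def)
    then have "f ` {?g x, ?g y} = f ` {a, b}" by simp
    then have "d = {f a, f b}" using xy inv by simp
    then show "\<exists>a\<in>f ` A. \<exists>b\<in>f ` B. d = {a, b}" using ab by blast
  qed
  then show "H \<in> P7_P5K2_free_bipartite"
    using G H free by (auto simp: P7_P5K2_free_bipartite_def bipartite_iff)
next
  fix G :: "nat graph" and U assume G: "G \<in> P7_P5K2_free_bipartite" and U: "U \<subseteq> verts G"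
  let ?H = "induced_subgraph G U"
  have H: "verts ?H = U" "edges ?H = {e \<in> edges G. e \<subseteq> U}" by (simp_all add: induced_subgraph_def)
  have free: "induced_free (path_graph 7) ?H" "induced_free P5_plus_K2 ?H"
    using G U by (auto simp: P7_P5K2_free_bipartite_def H intro!: induced_free_embedded[of _ G id])
  have "simple_graph ?H"
    using G U unfolding P7_P5K2_free_bipartite_def simple_graph_def H by (auto intro: finite_subset)
  moreover obtain A B where AB: "bipartition A B G" using G by (auto simp: P7_P5K2_free_bipartite_def bipartite_iff)
  have "bipartition (A \<inter> U) (B \<inter> U) ?H"
    unfolding bipartition_def H
  proof (intro conjI ballI)
    show "A \<inter> U \<union> B \<inter> U = U" "A \<inter> U \<inter> (B \<inter> U) = {}" using AB U by (auto simp: bipartition_def)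
    fix e assume e: "e \<in> {e \<in> edges G. e \<subseteq> U}"
    then have "e \<in> edges G" by simp
    then obtain a b where "a \<in> A" "b \<in> B" "e = {a, b}" using AB unfolding bipartition_def by meson
    then show "\<exists>a\<in>A \<inter> U. \<exists>b\<in>B \<inter> U. e = {a, b}" using e by blast
  qed
  ultimately show "?H \<in> P7_P5K2_free_bipartite"
    using G free by (auto simp: P7_P5K2_free_bipartite_def bipartite_iff)
qed

section \<open>The speed of the class\<close>

text \<open>
  The constants are generous. The lower one comes from \<open>m \<ge> n / 4\<close> and \<open>n - m \<ge> \<surd>n\<close> for
  \<open>m = n div 2\<close>, the upper one from \<open>2 \<le> n\<close> and \<open>n + 1 \<le> n\<^sup>2\<close>.
\<close>

lemma log_count_bounds:
  fixes n :: nat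
  assumes n: "4 \<le> n"
  defines "c \<equiv> labelled_count P7_P5K2_free_bipartite n"
  shows "0 < c" "1 / 8 * (real n * log 2 n) \<le> log 2 c" "log 2 c \<le> 61 * (real n * log 2 n)"
proof -
  define m where "m = n div 2"
  have m: "m \<le> n" "real n / 4 \<le> real m" "real n / 2 \<le> real (n - m)"
    using n unfolding m_def by (auto simp: field_simps)
  have ge: "(n - m) ^ m \<le> c" unfolding c_def using m(1) by (rule labelled_count_ge)
  have pos: "0 < n - m" using m(3) n by linarith
  then have "0 < (n - m) ^ m" by simp
  then show c: "0 < c" using ge by linarith
  have log0: "0 \<le> log 2 n" using n by simp
  have "real n \<le> (real n / 2) ^ 2" using n by (simp add: power2_eq_square field_simps)
  also have "\<dots> \<le> real (n - m) ^ 2" using m(3) by (intro power_mono) auto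
  finally have "log 2 n \<le> log 2 (real (n - m) ^ 2)" using n pos by (subst log_le_cancel_iff) auto
  also have "\<dots> = 2 * log 2 (n - m)" using pos by (simp add: log_nat_power)
  finally have l: "log 2 n / 2 \<le> log 2 (n - m)" by simp
  have "1 / 8 * (real n * log 2 n) = (real n / 4) * (log 2 n / 2)" by simp
  also have "\<dots> \<le> real m * log 2 (n - m)" using m(2) l log0 by (intro mult_mono) auto
  also have "\<dots> = log 2 (real ((n - m) ^ m))" using pos by (simp add: log_nat_power)
  also have "\<dots> \<le> log 2 c"
    using ge \<open>0 < (n - m) ^ m\<close> by (intro log_mono) (simp_all only: of_nat_le_iff of_nat_0_less_iff one_less_numeral_iff semiring_norm)
  finally show "1 / 8 * (real n * log 2 n) \<le> log 2 c" .
  have "c \<le> 2 ^ n * Suc n ^ (30 * n)" unfolding c_def by (rule labelled_count_le)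
  also have "\<dots> \<le> n ^ n * (n ^ 2) ^ (30 * n)"
    using n by (intro mult_mono power_mono) (auto simp: power2_eq_square intro: le_trans[of _ "2 * n"])
  also have "\<dots> = n ^ (61 * n)" by (simp flip: power_mult power_add)
  finally have "log 2 c \<le> log 2 (real (n ^ (61 * n)))"
    using c by (intro log_mono) (simp_all only: of_nat_le_iff of_nat_0_less_iff one_less_numeral_iff semiring_norm)
  also have "\<dots> = 61 * (real n * log 2 n)" using n by (simp add: log_nat_power)
  finally show "log 2 c \<le> 61 * (real n * log 2 n)" .
qed

theorem theorem13:
  "factorial_class
     {G :: nat graph. simple_graph G \<and> bipartite G \<and>
        induced_free (path_graph 7) G \<and>
        induced_free (disjoint_union (path_graph 5) (complete_graph 2)) G}"
  unfolding P7_P5K2_free_bipartite_def[symmetric] factorial_class_def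
proof (intro conjI bexI)
  let ?c = "labelled_count P7_P5K2_free_bipartite"
  show "hereditary_class P7_P5K2_free_bipartite" by (rule hereditary_P7_P5K2_free_bipartite)
  have ev: "\<forall>\<^sub>F n :: nat in sequentially. 4 \<le> n" by (rule eventually_ge_at_top)
  show "\<forall>\<^sub>F n in sequentially. real (?c n) = 2 powr log 2 (?c n)"
    using ev by eventually_elim (use log_count_bounds(1) in auto)
  show "(\<lambda>n. log 2 (?c n)) \<in> \<Theta>(\<lambda>n. real n * log 2 (real n))"
  proof (rule bigthetaI'[of "1 / 8" 61])
    show "\<forall>\<^sub>F n in sequentially. 1 / 8 * norm (real n * log 2 (real n)) \<le> norm (log 2 (?c n)) \<and>
        norm (log 2 (?c n)) \<le> 61 * norm (real n * log 2 (real n))"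
      using ev
    proof eventually_elim
      case (elim n)
      have "0 \<le> real n * log 2 (real n)" using elim by simp
      then show ?case using log_count_bounds(2,3)[OF elim] by simp
    qed
  qed simp_all
qed

end
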